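(* Let $\alpha>-1$, let $\Omega\subset\mathbb{R}^2$ be a bounded domain, let $F$ satisfy conditions (H1)--(H4) of the context on $\Omega$ with ellipticity constants $0<a\le A$, let $h:\overline\Omega\to\mathbb{R}^2$ and $V:\overline\Omega\to\mathbb{R}$ be continuous and bounded, and let $h$ satisfy (H5) of the context. Let $\Omega'\subset\subset\Omega$. Then there exists a constant $K=K(\Omega,\Omega',A,a,|h|_\infty,|V|_\infty)$ such that every positive viscosity solution $u$ of $$F(x,\nabla u,D^2u)+h(x)\cdot\nabla u\,|\nabla u|^\alpha+V(x)u^{1+\alpha}=0\quad\text{in }\Omega$$ satisfies $$\sup_{\Omega'}u\le K\inf_{\Omega'}u .$$
   Context: $N=2$ here; $S$ denotes the space of real symmetric $N\times N$ matrices, and $\alpha>-1$ is a fixed exponent. Conditions on $F$: (H1) $F:\Omega\times(\mathbb{R}^N\setminus\{0\})\times S\to\mathbb{R}$ is continuous, and for all $t\in\mathbb{R}\setminus\{0\}$, $\mu\ge0$: $F(x,tp,\mu X)=|t|^\alpha\mu F(x,p,X)$. (H2) For all $x \in \Omega$, $p\in\mathbb{R}^N\setminus\{0\}$, $M\in S$, $P\in S$ with $P\ge0$: $a|p|^\alpha\operatorname{tr}(P)\le F(x,p,M+P)-F(x,p,M)\le A|p|^\alpha\operatorname{tr}(P)$. (H3) There is a continuous function $\tilde\omega$ with $\tilde\omega(0)=0$ such that for all $x,y\in\Omega$, $p\ne0$, $X\in S$: $|F(x,p,X)-F(y,p,X)|\le\tilde\omega(|x-y|)|p|^\alpha|X|$.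 (H4) There is a continuous function $\omega$ with $\omega(0)=0$ such that if $X,Y\in S$ and $\zeta\in\mathbb{R}^+$ satisfy $$-\zeta\begin{pmatrix}I&0\\0&I\end{pmatrix}\le\begin{pmatrix}X&0\\0&Y\end{pmatrix}\le4\zeta\begin{pmatrix}I&-I\\-I&I\end{pmatrix}$$ ($I$ the $N\times N$ identity), then for all $x\neq y$ in $\Omega$: $F(x,\zeta(x-y),X)-F(y,\zeta(x-y),-Y)\le\omega(\zeta|x-y|^2)$. (When $F$ is independent of $x$, (H3) and (H4) are not needed.) (H5) Either $\alpha\le0$ and $h$ is Hölder continuous of exponent $1+\alpha$, or $\alpha>0$ and $(h(x)-h(y))\cdot(x-y)\le0$ for all $x,y$. Viscosity solutions: equations are understood in the following viscosity sense, in which one does not test when the gradient of the test function vanishes. For continuous $W,f$, a continuous function $u$ satisfies $F(x,\nabla u,D^2u)+h\cdot\nabla u|\nabla u|^\alpha+W|u|^\alpha u\le f$ (resp. $\ge f$) in an open set if for every point $x_0$ of it either (i) $u$ is constant, equal to $c$, on some ball around $x_0$ and $W(x)|c|^\alpha c\le f(x)$ (resp. $\ge f(x)$) on that ball, or (ii) for every $C^2$ function $\varphi$ such that $u-\varphi$ has a local minimum (resp. maximum) at $x_0$ and $\nabla\varphi(x_0)\ne0$, one has $F(x_0,\nabla\varphi(x_0),D^2\varphi(x_0))+h(x_0)\cdot\nabla\varphi(x_0)|\nabla\varphi(x_0)|^\alpha+W(x_0)|u(x_0)|^\alpha u(x_0)\le f(x_0)$ (resp. $\ge f(x_0)$). A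 solution is a function satisfying both inequalities. $|\cdot|_\infty$ is the sup norm; $\Omega'\subset\subset\Omega$ means $\overline{\Omega'}$ is a compact subset of $\Omega$. *)

theory Defs
  imports "HOL-Analysis.Analysis"
begin

definition sym_mat :: "(real ^ 'n ^ 'n) set"
  where "sym_mat = {X. transpose X = X}"

definition psd :: "real ^ 'n ^ 'n \<Rightarrow> bool"
  where "psd P \<longleftrightarrow> (\<forall>v. 0 \<le> v \<bullet> (P *v v))"

text \<open>The library order on \<open>real ^ 'n ^ 'n\<close> is componentwise, so the order of
  quadratic forms needs its own symbol.\<close>

definition loewner_le :: "real ^ 'n ^ 'n \<Rightarrow> real ^ 'n ^ 'n \<Rightarrow> bool" (infix "\<preceq>\<^sub>L" 50)
  where "X \<preceq>\<^sub>L Y \<longleftrightarrow> psd (Y - X)"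

definition block_mat ::
  "real ^ 'n ^ 'n \<Rightarrow> real ^ 'n ^ 'n \<Rightarrow> real ^ 'n ^ 'n \<Rightarrow> real ^ 'n ^ 'n
    \<Rightarrow> real ^ ('n + 'n) ^ ('n + 'n)"
  where "block_mat A B C D = (\<chi> i j. case i of
      Inl k \<Rightarrow> (case j of Inl l \<Rightarrow> A $ k $ l | Inr l \<Rightarrow> B $ k $ l)
    | Inr k \<Rightarrow> (case j of Inl l \<Rightarrow> C $ k $ l | Inr l \<Rightarrow> D $ k $ l))"

text \<open>The nonlinearity \<open>F\<close> is a total function of \<open>x\<close>, \<open>p\<close>, \<open>X\<close>; only its values for
  \<open>x \<in> \<Omega>\<close>, \<open>p \<noteq> 0\<close> and symmetric \<open>X\<close> are ever constrained or used.\<close>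

type_synonym 'n nonlinearity = "real ^ 'n \<Rightarrow> real ^ 'n \<Rightarrow> real ^ 'n ^ 'n \<Rightarrow> real"

definition H1 :: "real \<Rightarrow> (real ^ 'n) set \<Rightarrow> 'n nonlinearity \<Rightarrow> bool"
  where "H1 \<alpha> \<Omega> F \<longleftrightarrow>
    continuous_on (\<Omega> \<times> (UNIV - {0}) \<times> sym_mat) (\<lambda>(x, p, X). F x p X) \<and>
    (\<forall>x\<in>\<Omega>. \<forall>p X t \<mu>. p \<noteq> 0 \<longrightarrow> X \<in> sym_mat \<longrightarrow> t \<noteq> 0 \<longrightarrow> 0 \<le> \<mu> \<longrightarrow>
       F x (t *\<^sub>R p) (\<mu> *\<^sub>R X) = \<bar>t\<bar> powr \<alpha> * \<mu> * F x p X)"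

definition H2 :: "real \<Rightarrow> real \<Rightarrow> real \<Rightarrow> (real ^ 'n) set \<Rightarrow> 'n nonlinearity \<Rightarrow> bool"
  where "H2 \<alpha> a A \<Omega> F \<longleftrightarrow>
    (\<forall>x\<in>\<Omega>. \<forall>p M P. p \<noteq> 0 \<longrightarrow> M \<in> sym_mat \<longrightarrow> P \<in> sym_mat \<longrightarrow> psd P \<longrightarrow>
       a * norm p powr \<alpha> * trace P \<le> F x p (M + P) - F x p M \<and>
       F x p (M + P) - F x p M \<le> A * norm p powr \<alpha> * trace P)"

definition modulus :: "(real \<Rightarrow> real) \<Rightarrow> bool"
  where "modulus \<omega> \<longleftrightarrow> continuous_on {0..} \<omega> \<and> \<omega> 0 = 0"

definition H3 :: "real \<Rightarrow> (real ^ 'n) set \<Rightarrow> 'n nonlinearity \<Rightarrow> bool"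
  where "H3 \<alpha> \<Omega> F \<longleftrightarrow>
    (\<exists>\<omega>. modulus \<omega> \<and>
       (\<forall>x\<in>\<Omega>. \<forall>y\<in>\<Omega>. \<forall>p X. p \<noteq> 0 \<longrightarrow> X \<in> sym_mat \<longrightarrow>
          \<bar>F x p X - F y p X\<bar> \<le> \<omega> (norm (x - y)) * norm p powr \<alpha> * norm X))"

definition H4 :: "(real ^ 'n) set \<Rightarrow> 'n nonlinearity \<Rightarrow> bool"
  where "H4 \<Omega> F \<longleftrightarrow>
    (\<exists>\<omega>. modulus \<omega> \<and>
       (\<forall>X\<in>sym_mat. \<forall>Y\<in>sym_mat. \<forall>\<zeta>>0.
          (- \<zeta>) *\<^sub>R block_mat (mat 1) 0 0 (mat 1) \<preceq>\<^sub>L block_mat X 0 0 Y \<longrightarrow>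
          block_mat X 0 0 Y
            \<preceq>\<^sub>L (4 * \<zeta>) *\<^sub>R block_mat (mat 1) (- mat 1) (- mat 1) (mat 1) \<longrightarrow>
          (\<forall>x\<in>\<Omega>. \<forall>y\<in>\<Omega>. x \<noteq> y \<longrightarrow>
             F x (\<zeta> *\<^sub>R (x - y)) X - F y (\<zeta> *\<^sub>R (x - y)) (- Y)
               \<le> \<omega> (\<zeta> * (norm (x - y))\<^sup>2))))"

definition holder_on :: "real \<Rightarrow> (real ^ 'n) set \<Rightarrow> (real ^ 'n \<Rightarrow> real ^ 'n) \<Rightarrow> bool"
  where "holder_on \<gamma> D h \<longleftrightarrow>
    (\<exists>C. \<forall>x\<in>D. \<forall>y\<in>D. norm (h x - h y) \<le> C * norm (x - y) powr \<gamma>)"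

definition H5 :: "real \<Rightarrow> (real ^ 'n) set \<Rightarrow> (real ^ 'n \<Rightarrow> real ^ 'n) \<Rightarrow> bool"
  where "H5 \<alpha> D h \<longleftrightarrow>
    (\<alpha> \<le> 0 \<and> holder_on (1 + \<alpha>) D h) \<or>
    (\<alpha> > 0 \<and> (\<forall>x\<in>D. \<forall>y\<in>D. (h x - h y) \<bullet> (x - y) \<le> 0))"

text \<open>\<open>\<phi>\<close> is of class \<open>C\<^sup>2\<close> on the open set \<open>U\<close>, with gradient \<open>g\<close> and Hessian \<open>H\<close>.\<close>

definition C2_on ::
  "(real ^ 'n) set \<Rightarrow> (real ^ 'n \<Rightarrow> real) \<Rightarrow> (real ^ 'n \<Rightarrow> real ^ 'n)
    \<Rightarrow> (real ^ 'n \<Rightarrow> real ^ 'n ^ 'n) \<Rightarrow> bool"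
  where "C2_on U \<phi> g H \<longleftrightarrow>
    (\<forall>x\<in>U. GDERIV \<phi> x :> g x \<and> (g has_derivative (\<lambda>v. H x *v v)) (at x)) \<and>
    continuous_on U H"

definition lhs_op ::
  "real \<Rightarrow> 'n nonlinearity \<Rightarrow> (real ^ 'n \<Rightarrow> real ^ 'n) \<Rightarrow> (real ^ 'n \<Rightarrow> real)
    \<Rightarrow> real ^ 'n \<Rightarrow> real \<Rightarrow> real ^ 'n \<Rightarrow> real ^ 'n ^ 'n \<Rightarrow> real"
  where "lhs_op \<alpha> F h W x r p X =
    F x p X + (h x \<bullet> p) * norm p powr \<alpha> + W x * \<bar>r\<bar> powr \<alpha> * r"

text \<open>\<open>visc_le\<close> / \<open>visc_ge\<close>: in the viscosity sense, in the open set \<open>U\<close>,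
  \<open>F(x,\<nabla>u,D\<^sup>2u) + h\<cdot>\<nabla>u |\<nabla>u|\<^sup>\<alpha> + W |u|\<^sup>\<alpha> u \<le> f\<close>, respectively \<open>\<ge> f\<close>.
  Nothing is tested where the gradient of the test function vanishes.
  The two alternatives at \<open>x0\<close> form a plain disjunction; the second one holds vacuously if
  \<open>u\<close> is constant near \<open>x0\<close>, so every solution in the stricter reading (first alternative
  mandatory where \<open>u\<close> is locally constant) is a solution in this sense.\<close>

definition visc_le ::
  "real \<Rightarrow> (real ^ 'n) set \<Rightarrow> 'n nonlinearity \<Rightarrow> (real ^ 'n \<Rightarrow> real ^ 'n)
    \<Rightarrow> (real ^ 'n \<Rightarrow> real) \<Rightarrow> (real ^ 'n \<Rightarrow> real) \<Rightarrow> (real ^ 'n \<Rightarrow> real) \<Rightarrow> bool"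
  where "visc_le \<alpha> U F h W f u \<longleftrightarrow> continuous_on U u \<and>
    (\<forall>x0\<in>U.
      (\<exists>c. \<exists>r>0. ball x0 r \<subseteq> U \<and>
         (\<forall>x\<in>ball x0 r. u x = c \<and> W x * \<bar>c\<bar> powr \<alpha> * c \<le> f x)) \<or>
      (\<forall>\<phi> g H. C2_on U \<phi> g H \<longrightarrow>
         (\<forall>\<^sub>F x in nhds x0. u x0 - \<phi> x0 \<le> u x - \<phi> x) \<longrightarrow> g x0 \<noteq> 0 \<longrightarrow>
         lhs_op \<alpha> F h W x0 (u x0) (g x0) (H x0) \<le> f x0))"

definition visc_ge ::
  "real \<Rightarrow> (real ^ 'n) set \<Rightarrow> 'n nonlinearity \<Rightarrow> (real ^ 'n \<Rightarrow> real ^ 'n)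
    \<Rightarrow> (real ^ 'n \<Rightarrow> real) \<Rightarrow> (real ^ 'n \<Rightarrow> real) \<Rightarrow> (real ^ 'n \<Rightarrow> real) \<Rightarrow> bool"
  where "visc_ge \<alpha> U F h W f u \<longleftrightarrow> continuous_on U u \<and>
    (\<forall>x0\<in>U.
      (\<exists>c. \<exists>r>0. ball x0 r \<subseteq> U \<and>
         (\<forall>x\<in>ball x0 r. u x = c \<and> W x * \<bar>c\<bar> powr \<alpha> * c \<ge> f x)) \<or>
      (\<forall>\<phi> g H. C2_on U \<phi> g H \<longrightarrow>
         (\<forall>\<^sub>F x in nhds x0. u x - \<phi> x \<le> u x0 - \<phi> x0) \<longrightarrow> g x0 \<noteq> 0 \<longrightarrow>
         lhs_op \<alpha> F h W x0 (u x0) (g x0) (H x0) \<ge> f x0))"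

definition visc_solution ::
  "real \<Rightarrow> (real ^ 'n) set \<Rightarrow> 'n nonlinearity \<Rightarrow> (real ^ 'n \<Rightarrow> real ^ 'n)
    \<Rightarrow> (real ^ 'n \<Rightarrow> real) \<Rightarrow> (real ^ 'n \<Rightarrow> real) \<Rightarrow> (real ^ 'n \<Rightarrow> real) \<Rightarrow> bool"
  where "visc_solution \<alpha> U F h W f u \<longleftrightarrow>
    visc_le \<alpha> U F h W f u \<and> visc_ge \<alpha> U F h W f u"

end

theory Submission
  imports Defs
begin

text \<open>
  Test functions that are affine in a Gaussian \<open>exp (- \<eta> |x - z|\<^sup>2)\<close> suffice: away from its centre
  and for large \<open>\<eta>\<close> the second-order term of a Gaussian dominates all lower-order terms, so a
  solution touched by one is large compared with the gradient there. This has two consequences. On a small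
  disc around \<open>P\<close>, the set where \<open>u > u P / 2\<close> connects \<open>P\<close> to the boundary. And a point where \<open>u\<close> is
  tiny can be joined to any prescribed small disc by a path on which \<open>u\<close> is still below \<open>u P / 2\<close>;
  chaining such paths, one crosses lengthwise each of the four thin rectangles that surround \<open>P\<close>. In the plane
  the high path has to cross one of the low paths, which bounds \<open>u P / u Q\<close> for \<open>Q\<close> near \<open>P\<close>.
  Connectedness and compactness make the bound uniform on \<open>\<Omega>'\<close>.
\<close>

subsection \<open>Gaussian test functions\<close>

definition gauss :: "real \<Rightarrow> 'a::real_normed_vector \<Rightarrow> 'a \<Rightarrow> real"
  where "gauss \<eta> z x = exp (- \<eta> * (norm (x - z))\<^sup>2)"

lemma gauss_pos: "0 < gauss \<eta> z x"
  by (simp add: gauss_def)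

lemma continuous_on_gauss [continuous_intros]: "continuous_on S (gauss \<eta> z)"
  unfolding gauss_def by (intro continuous_intros)

lemma gauss_le: "\<eta> \<ge> 0 \<Longrightarrow> r \<ge> 0 \<Longrightarrow> r \<le> norm (x - z) \<Longrightarrow> gauss \<eta> z x \<le> exp (- \<eta> * r\<^sup>2)"
  unfolding gauss_def by (simp add: mult_left_mono power_mono)

lemma gauss_ge: "\<eta> \<ge> 0 \<Longrightarrow> norm (x - z) \<le> r \<Longrightarrow> exp (- \<eta> * r\<^sup>2) \<le> gauss \<eta> z x"
  unfolding gauss_def by (simp add: mult_left_mono power_mono)

lemma gauss_le_1: "\<eta> \<ge> 0 \<Longrightarrow> gauss \<eta> z x \<le> 1"
  unfolding gauss_def by simp

definition outer :: "real ^ 'n \<Rightarrow> real ^ 'n ^ 'n"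
  where "outer y = (\<chi> i j. y $ i * y $ j)"

section \<open>Rank-one matrices, quadratic forms, and the derivatives of a Gaussian\<close>

lemma outer_mult_vec: "outer y *v v = (y \<bullet> v) *\<^sub>R y"
  by (simp add: vec_eq_iff outer_def matrix_vector_mult_def inner_vec_def sum_distrib_left mult_ac)

lemma sym_mat_outer: "outer y \<in> sym_mat"
  by (simp add: sym_mat_def outer_def transpose_def vec_eq_iff)

lemma sym_mat_mat: "mat k \<in> sym_mat"
  by (simp add: sym_mat_def transpose_mat)

lemma sym_mat_scaleR: "X \<in> sym_mat \<Longrightarrow> c *\<^sub>R X \<in> sym_mat"
  by (simp add: sym_mat_def transpose_def vec_eq_iff)

lemma sym_mat_diff: "X \<in> sym_mat \<Longrightarrow> Y \<in> sym_mat \<Longrightarrow> X - Y \<in> sym_mat"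
  by (simp add: sym_mat_def transpose_def vec_eq_iff)

lemma psd_scaleR: "psd X \<Longrightarrow> 0 \<le> c \<Longrightarrow> psd (c *\<^sub>R X)"
  by (simp add: psd_def scaleR_matrix_vector_assoc [symmetric])

lemma psd_outer: "psd (outer y)"
  by (simp add: psd_def outer_mult_vec inner_commute)

lemma psd_mat_1: "psd (mat 1)"
  by (simp add: psd_def)

lemma trace_scaleR: "trace (c *\<^sub>R X) = c * trace (X :: real ^ 'n ^ 'n)"
  by (simp add: trace_def sum_distrib_left)

lemma trace_outer: "trace (outer y) = (norm y)\<^sup>2"
  by (simp add: trace_def outer_def power2_norm_eq_inner inner_vec_def)

text \<open>For positive \<open>\<eta>\<close> this is a difference of two positive semidefinite
  matrices, one of rank one and one a multiple of the identity, which is the shape that ellipticity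
  can estimate summand by summand.\<close>

definition gauss_hessian :: "real \<Rightarrow> real ^ 'n \<Rightarrow> real ^ 'n \<Rightarrow> real ^ 'n ^ 'n"
  where "gauss_hessian \<eta> z x =
    gauss \<eta> z x *\<^sub>R ((4 * \<eta>\<^sup>2) *\<^sub>R outer (x - z) - (2 * \<eta>) *\<^sub>R mat 1)"

lemma has_derivative_gauss:
  "(gauss \<eta> z has_derivative (\<lambda>v. (- 2 * \<eta> * gauss \<eta> z x) * ((x - z) \<bullet> v))) (at x)"
  for x :: "'a::real_inner"
  unfolding gauss_def power2_norm_eq_inner
  by (auto intro!: derivative_eq_intros simp: fun_eq_iff inner_commute algebra_simps)

text \<open>The factor \<open>\<kappa>\<close> has no sign restriction: tests from below use
  \<open>\<kappa> > 0\<close>, tests from above use its negative.\<close>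

lemma C2_on_gauss:
  "C2_on U (\<lambda>x. \<kappa> * gauss \<eta> z x) (\<lambda>x. (- 2 * \<eta> * \<kappa> * gauss \<eta> z x) *\<^sub>R (x - z))
    (\<lambda>x. \<kappa> *\<^sub>R gauss_hessian \<eta> z x)"
  unfolding C2_on_def
proof (intro conjI ballI)
  fix x assume "x \<in> U"
  show "GDERIV (\<lambda>x. \<kappa> * gauss \<eta> z x) x :> (- 2 * \<eta> * \<kappa> * gauss \<eta> z x) *\<^sub>R (x - z)"
    unfolding gderiv_def
    by (rule derivative_eq_intros has_derivative_gauss refl)+ (simp add: fun_eq_iff inner_commute algebra_simps)
  show "((\<lambda>x. (- 2 * \<eta> * \<kappa> * gauss \<eta> z x) *\<^sub>R (x - z)) has_derivative
      (*v) (\<kappa> *\<^sub>R gauss_hessian \<eta> z x)) (at x)"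
    by (rule derivative_eq_intros has_derivative_gauss refl)+
      (simp add: fun_eq_iff gauss_hessian_def scaleR_matrix_vector_assoc [symmetric]
        matrix_vector_mult_diff_rdistrib outer_mult_vec algebra_simps power2_eq_square)
next
  show "continuous_on U (\<lambda>x. \<kappa> *\<^sub>R gauss_hessian \<eta> z x)"
    unfolding gauss_hessian_def outer_def by (intro continuous_intros continuous_on_vec_lambda)
qed

subsection \<open>Solutions touched by Gaussians\<close>

text \<open>\<open>H2\<close> compares \<open>F\<close> only at ordered matrices, so it is applied
  twice: from \<open>0\<close> up to \<open>P\<close>, and from \<open>P - Q\<close> up to
  \<open>P\<close>. The base value \<open>F x p 0 = 0\<close> is homogeneity with
  \<open>\<mu> = 0\<close>.\<close>

lemma pucci_bounds:
  assumes "H1 \<alpha> \<Omega> F" "H2 \<alpha> a A \<Omega> F" "x \<in> \<Omega>" "p \<noteq> 0"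
    and "P \<in> sym_mat" "psd P" "Q \<in> sym_mat" "psd Q"
  shows "norm p powr \<alpha> * (a * trace P - A * trace Q) \<le> F x p (P - Q)"
    and "F x p (P - Q) \<le> norm p powr \<alpha> * (A * trace P - a * trace Q)"
proof -
  have "(0 :: real ^ 'a ^ 'a) \<in> sym_mat"
    using sym_mat_mat [of 0] by simp
  then have F0: "F x p 0 = 0"
    using assms(1,3,4) unfolding H1_def
    by (metis abs_1 mult_zero_left mult_zero_right one_neq_zero order_refl scaleR_one scaleR_zero_left)
  have PQ: "P - Q \<in> sym_mat"
    using assms sym_mat_diff by blast
  have 1: "a * norm p powr \<alpha> * trace Q \<le> F x p (P - Q + Q) - F x p (P - Q) \<and>
      F x p (P - Q + Q) - F x p (P - Q) \<le> A * norm p powr \<alpha> * trace Q"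
    using assms PQ unfolding H2_def by blast
  have 2: "a * norm p powr \<alpha> * trace P \<le> F x p (0 + P) - F x p 0 \<and>
      F x p (0 + P) - F x p 0 \<le> A * norm p powr \<alpha> * trace P"
    using assms \<open>0 \<in> sym_mat\<close> unfolding H2_def by blast
  show "norm p powr \<alpha> * (a * trace P - A * trace Q) \<le> F x p (P - Q)"
    "F x p (P - Q) \<le> norm p powr \<alpha> * (A * trace P - a * trace Q)"
    using 1 2 F0 by (simp_all add: algebra_simps)
qed

text \<open>The conclusion \<open>\<kappa> |\<nabla>G| < b u\<close> is homogeneous in \<open>u\<close>, which makes all later constants
  independent of \<open>u\<close> although the exponent \<open>\<alpha>\<close> no longer appears.\<close>

definition gauss_tested :: "real \<Rightarrow> (real ^ 'n) set \<Rightarrow> (real ^ 'n \<Rightarrow> real) \<Rightarrow> bool"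
  where "gauss_tested b \<Omega> u \<longleftrightarrow> continuous_on \<Omega> u \<and> (\<forall>x\<in>\<Omega>. 0 < u x) \<and>
    (\<forall>x0\<in>\<Omega>. \<forall>z \<kappa> \<eta>. 0 < \<kappa> \<longrightarrow> 0 < \<eta> \<longrightarrow> x0 \<noteq> z \<longrightarrow>
      (\<forall>\<^sub>F x in nhds x0. u x0 - \<kappa> * gauss \<eta> z x0 \<le> u x - \<kappa> * gauss \<eta> z x) \<or>
      (\<forall>\<^sub>F x in nhds x0. u x + \<kappa> * gauss \<eta> z x \<le> u x0 + \<kappa> * gauss \<eta> z x0) \<longrightarrow>
      b * (1 + 1 / norm (x0 - z)) \<le> 2 * \<eta> * norm (x0 - z) \<longrightarrow>
      \<kappa> * gauss \<eta> z x0 * (2 * \<eta> * norm (x0 - z)) < b * u x0)"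

text \<open>Write \<open>q\<close> for the length of the gradient of the test function and
  \<open>r\<close> for the distance to the centre. The two parts of the Hessian have traces
  \<open>q * s\<close> and \<open>q * (n / r)\<close>, so the second-order term contributes at least
  \<open>q powr (1 + \<alpha>) * (a * s - A * n / r)\<close>. The drift costs at most
  \<open>h_sup * q powr (1 + \<alpha>)\<close>, and the zero-order term has to balance what
  remains.\<close>

lemma visc_solution_gauss_estimate:
  fixes u :: "real ^ 'n \<Rightarrow> real"
  assumes F: "H1 \<alpha> \<Omega> F" "H2 \<alpha> a A \<Omega> F"
    and h: "\<And>x. x \<in> \<Omega> \<Longrightarrow> norm (h x) \<le> h_sup"
    and V: "\<And>x. x \<in> \<Omega> \<Longrightarrow> \<bar>V x\<bar> \<le> V_sup"
    and u: "visc_solution \<alpha> \<Omega> F h V (\<lambda>_. 0) u"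
    and x0: "x0 \<in> \<Omega>" "0 < u x0" "x0 \<noteq> z" and pos: "0 < \<kappa>" "0 < \<eta>"
    and touch: "(\<forall>\<^sub>F x in nhds x0. u x0 - \<kappa> * gauss \<eta> z x0 \<le> u x - \<kappa> * gauss \<eta> z x) \<or>
      (\<forall>\<^sub>F x in nhds x0. u x + \<kappa> * gauss \<eta> z x \<le> u x0 + \<kappa> * gauss \<eta> z x0)"
    and s: "s = 2 * \<eta> * norm (x0 - z)"
  shows "(\<kappa> * gauss \<eta> z x0 * s) powr (1 + \<alpha>) *
      (a * s - A * real CARD('n) / norm (x0 - z) - h_sup) \<le> V_sup * u x0 powr (1 + \<alpha>)"
proof -
  define G where "G = gauss \<eta> z x0"
  define r where "r = norm (x0 - z)"
  define n where "n = real CARD('n)"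
  define q where "q = \<kappa> * G * s"
  define P where "P = (\<kappa> * G * (4 * \<eta>\<^sup>2)) *\<^sub>R outer (x0 - z)"
  define Q where "Q = (\<kappa> * G * (2 * \<eta>)) *\<^sub>R (mat 1 :: real ^ 'n ^ 'n)"
  have G: "0 < G" and r: "0 < r" and q: "0 < q"
    using gauss_pos[of \<eta> z x0] x0 pos by (simp_all add: G_def r_def q_def s)
  have sr: "s = 2 * \<eta> * r"
    by (simp add: s r_def)
  have PQ: "P \<in> sym_mat" "psd P" "Q \<in> sym_mat" "psd Q"
    unfolding P_def Q_def using G pos
    by (auto intro!: sym_mat_scaleR psd_scaleR sym_mat_outer sym_mat_mat psd_outer psd_mat_1)
  have trP: "trace P = q * s"
    by (simp add: P_def q_def trace_scaleR trace_outer sr flip: r_def) (simp add: power2_eq_square)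
  have trQ: "trace Q = q * (n / r)"
    using r by (simp add: Q_def q_def trace_scaleR trace_I sr n_def)
  have hess: "\<kappa> *\<^sub>R gauss_hessian \<eta> z x0 = P - Q"
    by (simp add: gauss_hessian_def P_def Q_def G_def scaleR_diff_right mult_ac)
  have Vu: "\<bar>V x0 * \<bar>u x0\<bar> powr \<alpha> * u x0\<bar> \<le> V_sup * u x0 powr (1 + \<alpha>)"
    using V[OF x0(1)] x0(2) by (simp add: abs_mult powr_add mult_ac mult_right_mono)
  have hp: "\<bar>(h x0 \<bullet> p) * norm p powr \<alpha>\<bar> \<le> h_sup * q powr (1 + \<alpha>)" if "norm p = q" for p
  proof -
    have "\<bar>h x0 \<bullet> p\<bar> \<le> h_sup * q"
      using Cauchy_Schwarz_ineq2[of "h x0" p] h[OF x0(1)] q that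
      by (smt (verit) mult_right_mono)
    then show ?thesis
      using q that by (simp add: abs_mult powr_add mult_right_mono flip: mult.assoc)
  qed
  have qpow: "q powr \<alpha> * (q * t) = q powr (1 + \<alpha>) * t" for t
    using q by (simp add: powr_add)
  have lhs: "(\<kappa> * gauss \<eta> z x0 * s) powr (1 + \<alpha>) *
      (a * s - A * real CARD('n) / norm (x0 - z) - h_sup)
      = q powr \<alpha> * (a * trace P - A * trace Q) - h_sup * q powr (1 + \<alpha>)"
  proof -
    define t where "t = a * s - A * n / r"
    have eq: "a * trace P - A * trace Q = q * t"
      by (simp add: trP trQ t_def algebra_simps)
    have "q powr \<alpha> * (a * trace P - A * trace Q) = q powr (1 + \<alpha>) * t"
      unfolding eq by (rule qpow)
    moreover have "q powr (1 + \<alpha>) * (t - h_sup) = q powr (1 + \<alpha>) * t - h_sup * q powr (1 + \<alpha>)"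
      by (simp add: algebra_simps)
    ultimately have "q powr (1 + \<alpha>) * (t - h_sup)
        = q powr \<alpha> * (a * trace P - A * trace Q) - h_sup * q powr (1 + \<alpha>)"
      by linarith
    then show ?thesis
      unfolding t_def q_def G_def r_def n_def .
  qed
  \<comment> \<open>This rules out the locally constant alternative of the viscosity definition:
    there the touching condition would give the Gaussian itself a local maximum at
    \<open>x0\<close>, but its gradient vanishes only at the centre \<open>z\<close>.\<close>
  have not_const: False
    if "\<epsilon> > 0" "\<And>x. x \<in> ball x0 \<epsilon> \<Longrightarrow> u x = c" for \<epsilon> c
  proof -
    have "\<forall>\<^sub>F x in nhds x0. u x = c"
      using that unfolding eventually_nhds by (metis centre_in_ball open_ball)
    then have ux: "\<forall>\<^sub>F x in nhds x0. u x = u x0"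
      by (metis (mono_tags, lifting) eventually_mono eventually_nhds_x_imp_x)
    have "\<forall>\<^sub>F x in nhds x0. gauss \<eta> z x \<le> gauss \<eta> z x0"
      using touch
    proof
      assume "\<forall>\<^sub>F x in nhds x0. u x0 - \<kappa> * gauss \<eta> z x0 \<le> u x - \<kappa> * gauss \<eta> z x"
      with ux show ?thesis
        by eventually_elim (use pos in auto)
    next
      assume "\<forall>\<^sub>F x in nhds x0. u x + \<kappa> * gauss \<eta> z x \<le> u x0 + \<kappa> * gauss \<eta> z x0"
      with ux show ?thesis
        by eventually_elim (use pos in auto)
    qed
    then obtain S where "open S" "x0 \<in> S" "\<forall>x\<in>S. gauss \<eta> z x \<le> gauss \<eta> z x0"
      unfolding eventually_nhds by blast
    then have "(\<lambda>v. (- 2 * \<eta> * gauss \<eta> z x0) * ((x0 - z) \<bullet> v)) = (\<lambda>v. 0)"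
      by (intro differential_zero_maxmin[OF _ _ has_derivative_gauss]) auto
    from fun_cong[OF this, of "x0 - z"] show False
      using pos x0 G by (simp add: G_def)
  qed
  show ?thesis
    using touch
  proof
    assume touch_below: "\<forall>\<^sub>F x in nhds x0. u x0 - \<kappa> * gauss \<eta> z x0 \<le> u x - \<kappa> * gauss \<eta> z x"
    define p where "p = (- 2 * \<eta> * \<kappa> * gauss \<eta> z x0) *\<^sub>R (x0 - z)"
    have p: "norm p = q" "p \<noteq> 0"
      using pos G x0 by (auto simp: p_def q_def s G_def abs_mult)
    have "visc_le \<alpha> \<Omega> F h V (\<lambda>_. 0) u"
      using u by (simp add: visc_solution_def)
    with x0(1) not_const have "\<forall>\<phi> g H. C2_on \<Omega> \<phi> g H \<longrightarrow>
         (\<forall>\<^sub>F x in nhds x0. u x0 - \<phi> x0 \<le> u x - \<phi> x) \<longrightarrow> g x0 \<noteq> 0 \<longrightarrow>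
         lhs_op \<alpha> F h V x0 (u x0) (g x0) (H x0) \<le> 0"
      unfolding visc_le_def by blast
    from this[rule_format, OF C2_on_gauss touch_below] p(2)
    have "F x0 p (P - Q) + (h x0 \<bullet> p) * norm p powr \<alpha> + V x0 * \<bar>u x0\<bar> powr \<alpha> * u x0 \<le> 0"
      by (simp add: lhs_op_def hess p_def)
    moreover have "q powr \<alpha> * (a * trace P - A * trace Q) \<le> F x0 p (P - Q)"
      using pucci_bounds(1)[OF F x0(1) p(2) PQ] by (simp add: p)
    ultimately show ?thesis
      using hp[OF p(1)] Vu lhs by linarith
  next
    assume touch_above: "\<forall>\<^sub>F x in nhds x0. u x + \<kappa> * gauss \<eta> z x \<le> u x0 + \<kappa> * gauss \<eta> z x0"
    \<comment> \<open>Touching from above is a test by \<open>- \<kappa>\<close> times the Gaussian,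
      with Hessian \<open>Q - P\<close>; the upper ellipticity bound then gives the same inequality
      as in the other case.\<close>
    then have touch': "\<forall>\<^sub>F x in nhds x0.
        u x - (- \<kappa>) * gauss \<eta> z x \<le> u x0 - (- \<kappa>) * gauss \<eta> z x0"
      by simp
    define p where "p = (- 2 * \<eta> * (- \<kappa>) * gauss \<eta> z x0) *\<^sub>R (x0 - z)"
    have p: "norm p = q" "p \<noteq> 0"
      using pos G x0 by (auto simp: p_def q_def s G_def abs_mult)
    have "visc_ge \<alpha> \<Omega> F h V (\<lambda>_. 0) u"
      using u by (simp add: visc_solution_def)
    with x0(1) not_const have "\<forall>\<phi> g H. C2_on \<Omega> \<phi> g H \<longrightarrow>
         (\<forall>\<^sub>F x in nhds x0. u x - \<phi> x \<le> u x0 - \<phi> x0) \<longrightarrow> g x0 \<noteq> 0 \<longrightarrow>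
         lhs_op \<alpha> F h V x0 (u x0) (g x0) (H x0) \<ge> 0"
      unfolding visc_ge_def by blast
    from this[rule_format, OF C2_on_gauss touch'] p(2)
    have "F x0 p (Q - P) + (h x0 \<bullet> p) * norm p powr \<alpha> + V x0 * \<bar>u x0\<bar> powr \<alpha> * u x0 \<ge> 0"
      using hess by (simp add: lhs_op_def p_def)
    moreover have "F x0 p (Q - P) \<le> q powr \<alpha> * (A * trace Q - a * trace P)"
      using pucci_bounds(2)[OF F x0(1) p(2) PQ(3,4,1,2)] by (simp add: p)
    moreover have "q powr \<alpha> * (A * trace Q - a * trace P) = - (q powr \<alpha> * (a * trace P - A * trace Q))"
      by (simp add: algebra_simps)
    ultimately show ?thesis
      using hp[OF p(1)] Vu lhs by linarith
  qed
qed

text \<open>The steepness condition makes the bracket in the previous estimate at least 1. What is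
  left compares two powers with the positive exponent \<open>1 + \<alpha>\<close>, and taking the
  root removes \<open>\<alpha>\<close>.\<close>

lemma visc_solution_imp_gauss_tested:
  fixes \<Omega> :: "(real ^ 'n) set"
  assumes "\<alpha> > -1" "0 < a" "0 \<le> A"
  obtains b where "0 < b"
    and "\<And>F h V u. \<lbrakk>H1 \<alpha> \<Omega> F; H2 \<alpha> a A \<Omega> F; \<And>x. x \<in> \<Omega> \<Longrightarrow> norm (h x) \<le> h_sup;
      \<And>x. x \<in> \<Omega> \<Longrightarrow> \<bar>V x\<bar> \<le> V_sup; visc_solution \<alpha> \<Omega> F h V (\<lambda>_. 0) u; \<And>x. x \<in> \<Omega> \<Longrightarrow> 0 < u x\<rbrakk>
      \<Longrightarrow> gauss_tested b \<Omega> u"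
proof -
  define n where "n = real CARD('n)"
  \<comment> \<open>Adding 1 keeps \<open>c\<close> positive even for \<open>V_sup = 0\<close> and
    makes \<open>V_sup < c powr (1 + \<alpha>)\<close> strict.\<close>
  define c where "c = (\<bar>V_sup\<bar> + 1) powr (1 / (1 + \<alpha>))"
  \<comment> \<open>The entries of the maximum pay, in order, for the zero-order term, for the trace
    of the identity part (matched with \<open>1 / r\<close> in the steepness condition), and for the
    drift together with the final lower bound 1.\<close>
  define b where "b = max c (max (A * n / a) ((\<bar>h_sup\<bar> + 1) / a))"
  have c: "0 < c" "V_sup < c powr (1 + \<alpha>)"
    using \<open>\<alpha> > -1\<close> by (auto simp: c_def powr_powr)
  have b: "c \<le> b" "A * n \<le> a * b" "\<bar>h_sup\<bar> + 1 \<le> a * b"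
    using \<open>0 < a\<close> by (auto simp: b_def le_max_iff_disj max_mult_distrib_left)
  have "0 < b"
    using b c by simp
  moreover have "gauss_tested b \<Omega> u"
    if F: "H1 \<alpha> \<Omega> F" "H2 \<alpha> a A \<Omega> F"
      and hV: "\<And>x. x \<in> \<Omega> \<Longrightarrow> norm (h x) \<le> h_sup" "\<And>x. x \<in> \<Omega> \<Longrightarrow> \<bar>V x\<bar> \<le> V_sup"
      and u: "visc_solution \<alpha> \<Omega> F h V (\<lambda>_. 0) u" and upos: "\<And>x. x \<in> \<Omega> \<Longrightarrow> 0 < u x"
    for F h V u
    unfolding gauss_tested_def
  proof (intro conjI ballI allI impI)
    show "continuous_on \<Omega> u"
      using u by (simp add: visc_solution_def visc_le_def)
    fix x0 z \<kappa> \<eta>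
    assume x0: "x0 \<in> \<Omega>" "x0 \<noteq> z" and pos: "0 < \<kappa>" "0 < \<eta>"
      and touch: "(\<forall>\<^sub>F x in nhds x0. u x0 - \<kappa> * gauss \<eta> z x0 \<le> u x - \<kappa> * gauss \<eta> z x) \<or>
        (\<forall>\<^sub>F x in nhds x0. u x + \<kappa> * gauss \<eta> z x \<le> u x0 + \<kappa> * gauss \<eta> z x0)"
      and steep: "b * (1 + 1 / norm (x0 - z)) \<le> 2 * \<eta> * norm (x0 - z)"
    define r s q where "r = norm (x0 - z)" and "s = 2 * \<eta> * norm (x0 - z)"
      and "q = \<kappa> * gauss \<eta> z x0 * s"
    have r: "0 < r" and s: "0 < s" and q: "0 < q"
      using x0 pos gauss_pos[of \<eta> z x0] by (simp_all add: r_def s_def q_def)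
    have "1 \<le> a * s - A * n / r - h_sup"
    proof -
      have "a * (b * (1 + 1 / r)) \<le> a * s"
        using steep \<open>0 < a\<close> by (simp add: r_def s_def)
      moreover have "a * (b * (1 + 1 / r)) = a * b + (a * b) / r"
        by (simp add: algebra_simps)
      moreover have "A * n / r \<le> (a * b) / r"
        using b r by (simp add: divide_right_mono)
      ultimately show ?thesis
        using b by linarith
    qed
    then have "q powr (1 + \<alpha>) \<le> q powr (1 + \<alpha>) * (a * s - A * n / r - h_sup)"
      using q by (simp add: mult_le_cancel_left1)
    also have "\<dots> \<le> V_sup * u x0 powr (1 + \<alpha>)"
      using visc_solution_gauss_estimate[OF F hV u x0(1) upos x0(2) pos touch s_def] x0(1)
      by (simp add: q_def n_def r_def)
    also have "\<dots> < c powr (1 + \<alpha>) * u x0 powr (1 + \<alpha>)"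
      using c upos[OF x0(1)] by simp
    also have "\<dots> = (c * u x0) powr (1 + \<alpha>)"
      using c upos[OF x0(1)] by (simp add: powr_mult)
    finally have "q < c * u x0"
      using \<open>\<alpha> > -1\<close> q c upos[OF x0(1)] by (smt (verit) mult_pos_pos powr_mono2)
    also have "\<dots> \<le> b * u x0"
      using b upos[OF x0(1)] by simp
    finally show "\<kappa> * gauss \<eta> z x0 * (2 * \<eta> * norm (x0 - z)) < b * u x0"
      by (simp add: q_def s_def)
  qed (use upos in auto)
  ultimately show thesis
    using that by blast
qed

subsection \<open>High and low paths\<close>

text \<open>Path components of an open set are open. A limit point of one that lies in
  \<open>S\<close> has a component of its own meeting the first, so the two agree. Hence a frontier
  point must violate one of the conditions that define \<open>S\<close>.\<close>

lemma frontier_path_component_disjoint: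
  fixes S :: "'a::real_normed_vector set"
  assumes "open S"
  shows "frontier (path_component_set S x) \<inter> S = {}"
proof -
  let ?D = "path_component_set S x"
  have "y \<in> ?D" if y: "y \<in> closure ?D" "y \<in> S" for y
  proof -
    have "y \<in> path_component_set S y" "open (path_component_set S y)"
      using y assms by (auto simp: path_component_refl open_path_component)
    with y(1) have "path_component_set S y \<inter> closure ?D \<noteq> {}"
      by blast
    then have "path_component_set S y \<inter> ?D \<noteq> {}"
      using open_Int_closure_eq_empty[OF \<open>open (path_component_set S y)\<close>] by simp
    then obtain w where "path_component S y w" "path_component S x w"
      by auto
    then show ?thesis
      using path_component_trans[OF _ path_component_sym] by simp
  qed
  then show ?thesis
    using open_path_component[OF assms, of x] by (auto simp: frontier_def interior_open)
qed

lemma gauss_testedD: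
  assumes "gauss_tested b \<Omega> u"
  shows "continuous_on \<Omega> u" "x \<in> \<Omega> \<Longrightarrow> 0 < u x"
  using assms by (auto simp: gauss_tested_def)

lemma gauss_tested_below:
  assumes "gauss_tested b \<Omega> u" "x0 \<in> \<Omega>" "x0 \<noteq> z" "0 < \<kappa>" "0 < \<eta>"
    and "open D" "x0 \<in> D" "\<And>x. x \<in> D \<Longrightarrow> u x0 - \<kappa> * gauss \<eta> z x0 \<le> u x - \<kappa> * gauss \<eta> z x"
    and "b * (1 + 1 / norm (x0 - z)) \<le> 2 * \<eta> * norm (x0 - z)"
  shows "\<kappa> * gauss \<eta> z x0 * (2 * \<eta> * norm (x0 - z)) < b * u x0"
proof -
  have "\<forall>\<^sub>F x in nhds x0. u x0 - \<kappa> * gauss \<eta> z x0 \<le> u x - \<kappa> * gauss \<eta> z x"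
    using assms(6-8) unfolding eventually_nhds by blast
  then show ?thesis
    using assms(1)[unfolded gauss_tested_def, THEN conjunct2, THEN conjunct2, rule_format,
        OF assms(2,4,5,3) _ assms(9)] by simp
qed

lemma gauss_tested_above:
  assumes "gauss_tested b \<Omega> u" "x0 \<in> \<Omega>" "x0 \<noteq> z" "0 < \<kappa>" "0 < \<eta>"
    and "open D" "x0 \<in> D" "\<And>x. x \<in> D \<Longrightarrow> u x + \<kappa> * gauss \<eta> z x \<le> u x0 + \<kappa> * gauss \<eta> z x0"
    and "b * (1 + 1 / norm (x0 - z)) \<le> 2 * \<eta> * norm (x0 - z)"
  shows "\<kappa> * gauss \<eta> z x0 * (2 * \<eta> * norm (x0 - z)) < b * u x0"
proof -
  have "\<forall>\<^sub>F x in nhds x0. u x + \<kappa> * gauss \<eta> z x \<le> u x0 + \<kappa> * gauss \<eta> z x0"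
    using assms(6-8) unfolding eventually_nhds by blast
  then show ?thesis
    using assms(1)[unfolded gauss_tested_def, THEN conjunct2, THEN conjunct2, rule_format,
        OF assms(2,4,5,3) _ assms(9)] by simp
qed

text \<open>The supersolution used here is \<open>2 exp (- \<eta>) - G\<close>, with the centre of \<open>G\<close> at distance \<open>1 + R\<close>
  from \<open>P\<close>; on the disc of radius \<open>R\<close> it varies by less than a factor 2.\<close>

lemma frontier_value_gt_half:
  assumes "0 < b"
  obtains R where "0 < R"
    and "\<And>\<Omega> u P D. \<lbrakk>gauss_tested b \<Omega> u; open D; P \<in> D; D \<subseteq> cball P R; closure D \<subseteq> \<Omega>\<rbrakk>
      \<Longrightarrow> \<exists>y\<in>frontier D. u P / 2 < u (y :: real ^ 'n)"
proof -
  \<comment> \<open>On the disc the exponent of the Gaussian varies by at most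
    \<open>\<eta> * 8 * R = 24 * b * R \<le> 1\<close>. Since \<open>exp 1 \<le> 3\<close>, the
    Gaussian stays between \<open>S / 3\<close> and \<open>S\<close>.\<close>
  define R where "R = min 1 (1 / (24 * b))"
  have R: "0 < R" "R \<le> 1" "24 * b * R \<le> 1"
    using \<open>0 < b\<close> by (auto simp: R_def min_def field_simps)
  \<comment> \<open>At distance \<open>r \<ge> 1\<close> this gives
    \<open>2 * \<eta> * r \<ge> 6 * b\<close>. That exceeds the required steepness, at most
    \<open>2 * b\<close>, and offsets the factor 6 between the bounds \<open>S / 3\<close> for the
    Gaussian and \<open>2 * S\<close> for \<open>\<psi>\<close>.\<close>
  define \<eta> where "\<eta> = 3 * b"
  define S where "S = exp (- \<eta>)"
  have \<eta>: "0 < \<eta>" and S: "0 < S"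
    using \<open>0 < b\<close> by (auto simp: \<eta>_def S_def)
  have main: "\<exists>y\<in>frontier D. u P / 2 < u y"
    if u: "gauss_tested b \<Omega> u" and D: "open D" "P \<in> D" "D \<subseteq> cball P R" "closure D \<subseteq> \<Omega>"
    for \<Omega> D :: "(real ^ 'n) set" and u P
  proof -
    obtain w :: "real ^ 'n" where w: "norm w = 1 + R"
      using vector_choose_size[of "1 + R"] R by auto
    define z where "z = P + w"
    define \<psi> where "\<psi> x = 2 * S - gauss \<eta> z x" for x
    have clD: "closure D \<subseteq> cball P R"
      using D(3) by (simp add: closure_minimal)
    have dist_z: "1 \<le> norm (x - z)" "norm (x - z) \<le> 1 + 2 * R" if "x \<in> closure D" for x
    proof -
      have "norm (x - P) \<le> R"
        using that clD by (auto simp: dist_norm norm_minus_commute)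
      moreover have "norm (x - z) = norm ((x - P) - w)"
        by (simp add: z_def algebra_simps)
      ultimately show "1 \<le> norm (x - z)" "norm (x - z) \<le> 1 + 2 * R"
        using w norm_triangle_ineq4[of "x - P" w] norm_triangle_ineq2[of w "x - P"]
          norm_minus_commute[of w "x - P"] by linarith+
    qed
    have gauss_bounds: "S / 3 \<le> gauss \<eta> z x" "gauss \<eta> z x \<le> S" if "x \<in> closure D" for x
    proof -
      show "gauss \<eta> z x \<le> S"
        using gauss_le[of \<eta> 1 x z] dist_z[OF that] \<eta> by (simp add: S_def)
      have "\<eta> * (4 * R + 4 * R\<^sup>2) \<le> 1"
      proof -
        have "R\<^sup>2 \<le> R"
          using R by (simp add: power2_eq_square mult_left_le)
        then have "\<eta> * (4 * R + 4 * R\<^sup>2) \<le> \<eta> * (8 * R)"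
          using \<eta> by (intro mult_left_mono) auto
        then show ?thesis
          using R by (simp add: \<eta>_def mult_ac)
      qed
      moreover have "- \<eta> * (1 + 2 * R)\<^sup>2 = - \<eta> - \<eta> * (4 * R + 4 * R\<^sup>2)"
        by (simp add: power2_eq_square algebra_simps)
      ultimately have "exp (- \<eta> - 1) \<le> exp (- \<eta> * (1 + 2 * R)\<^sup>2)"
        by simp
      also have "\<dots> \<le> gauss \<eta> z x"
        using dist_z[OF that] \<eta> by (intro gauss_ge) auto
      finally have "exp (- \<eta> - 1) \<le> gauss \<eta> z x" .
      moreover have "S / 3 \<le> exp (- \<eta> - 1)"
        using divide_left_mono[of "exp 1" 3 S] exp_le S by (simp add: S_def exp_diff)
      ultimately show "S / 3 \<le> gauss \<eta> z x"
        by simp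
    qed
    have \<psi>: "S \<le> \<psi> x" "\<psi> x < 2 * S" if "x \<in> closure D" for x
      using gauss_bounds[OF that] gauss_pos[of \<eta> z x] by (auto simp: \<psi>_def)
    have "compact (closure D)"
      unfolding compact_closure by (rule bounded_subset[OF bounded_cball D(3)])
    moreover have "P \<in> closure D"
      using D closure_subset by blast
    moreover have "continuous_on (closure D) (\<lambda>x. u x / \<psi> x)"
      unfolding \<psi>_def
    proof (intro continuous_intros ballI)
      show "continuous_on (closure D) u"
        using gauss_testedD(1)[OF u] D(4) continuous_on_subset by blast
      show "2 * S - gauss \<eta> z x \<noteq> 0" if "x \<in> closure D" for x
        using \<psi>(1)[OF that] S by (simp add: \<psi>_def)
    qed
    ultimately have "\<exists>x0\<in>closure D. \<forall>x\<in>closure D. u x / \<psi> x \<le> u x0 / \<psi> x0"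
      by (intro continuous_attains_sup) auto
    then obtain x0 where x0: "x0 \<in> closure D"
      and max: "\<And>x. x \<in> closure D \<Longrightarrow> u x / \<psi> x \<le> u x0 / \<psi> x0"
      by auto
    \<comment> \<open>The least multiple of \<open>\<psi>\<close> that lies above \<open>u\<close>
      on \<open>closure D\<close>; it touches \<open>u\<close> at \<open>x0\<close>. The estimate
      for tested functions excludes a touching point inside \<open>D\<close>.\<close>
    define \<kappa> where "\<kappa> = u x0 / \<psi> x0"
    have ux0: "u x0 = \<kappa> * \<psi> x0" and \<kappa>: "0 < \<kappa>"
      using \<psi>[OF x0] S gauss_testedD(2)[OF u, of x0] D(4) x0 by (auto simp: \<kappa>_def)
    have le: "u x \<le> \<kappa> * \<psi> x" if "x \<in> closure D" for x
      using max[OF that] \<psi>(1)[OF that] S by (simp add: \<kappa>_def pos_divide_le_eq)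
    have "x0 \<notin> D"
    proof
      assume "x0 \<in> D"
      define r where "r = norm (x0 - z)"
      have r: "1 \<le> r"
        using dist_z[OF x0] by (simp add: r_def)
      have "b * (1 + 1 / r) \<le> b * 2"
        using r \<open>0 < b\<close> by simp
      also have "\<dots> \<le> 2 * \<eta> * r"
        using mult_left_mono[of 1 r "6 * b"] r \<open>0 < b\<close> by (simp add: \<eta>_def)
      finally have steep: "b * (1 + 1 / r) \<le> 2 * \<eta> * r" .
      have touch: "u x + \<kappa> * gauss \<eta> z x \<le> u x0 + \<kappa> * gauss \<eta> z x0" if "x \<in> D" for x
        using le[of x] that closure_subset ux0 by (auto simp: \<psi>_def algebra_simps)
      have "\<kappa> * gauss \<eta> z x0 * (2 * \<eta> * r) < b * u x0"
        unfolding r_def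
      proof (rule gauss_tested_above[OF u _ _ \<kappa> \<eta> \<open>open D\<close> \<open>x0 \<in> D\<close> touch])
        show "x0 \<in> \<Omega>" "x0 \<noteq> z"
          using x0 D(4) r by (auto simp: r_def)
        show "b * (1 + 1 / norm (x0 - z)) \<le> 2 * \<eta> * norm (x0 - z)"
          using steep by (simp only: r_def)
      qed
      also have "\<dots> \<le> b * (\<kappa> * (2 * S))"
        using \<psi>[OF x0] \<kappa> \<open>0 < b\<close> by (simp add: ux0)
      also have "\<dots> = \<kappa> * (S / 3) * (6 * b)"
        by simp
      also have "\<dots> \<le> \<kappa> * gauss \<eta> z x0 * (2 * \<eta> * r)"
      proof (rule mult_mono)
        show "6 * b \<le> 2 * \<eta> * r"
          using mult_left_mono[of 1 r "6 * b"] r \<open>0 < b\<close> by (simp add: \<eta>_def)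
      qed (use gauss_bounds[OF x0] \<kappa> \<open>0 < b\<close> gauss_pos[of \<eta> z x0] in auto)
      finally show False
        by simp
    qed
    then have "x0 \<in> frontier D"
      using x0 D(1) by (simp add: frontier_def interior_open)
    \<comment> \<open>\<open>\<psi>\<close> has values in the interval from \<open>S\<close> to
      \<open>2 * S\<close>, so moving from \<open>P\<close> to \<open>x0\<close> loses less than a
      factor 2.\<close>
    moreover have "u P / 2 < u x0"
    proof -
      have P: "P \<in> closure D"
        by fact
      have "u P \<le> \<kappa> * \<psi> P"
        by (rule le[OF P])
      also have "\<dots> < \<kappa> * (2 * \<psi> x0)"
        using \<psi>[OF P] \<psi>[OF x0] \<kappa> by simp
      finally show ?thesis
        using ux0 by simp
    qed
    ultimately show ?thesis
      by blast
  qed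
  show thesis
    using R(1) main by (rule that)
qed

text \<open>The barrier is \<open>m * (gauss \<eta> z y - k)\<close>, which vanishes on the sphere
  of radius \<open>\<rho>\<close>. If the component of \<open>x\<close> in the set where
  \<open>u\<close> lies below it missed the small ball, \<open>u - m * gauss \<eta> z\<close> would
  have an interior minimum on that component, at a point where the Gaussian is steep and
  \<open>u\<close> is too small for the tested estimate.\<close>

lemma low_path_to_ball:
  assumes "0 < b" "0 < \<epsilon>" "0 \<le> \<rho>1" "\<rho>1 < \<rho>"
  obtains c where "0 < c" "c \<le> 1"
    and "\<And>\<Omega> u z x m. \<lbrakk>gauss_tested b \<Omega> u; cball z \<rho> \<subseteq> \<Omega>; x \<in> cball z \<rho>1; u x < c * m\<rbrakk>
      \<Longrightarrow> \<exists>x'\<in>cball z \<epsilon>. path_component {y \<in> ball z \<rho>. u y < m} x (x' :: real ^ 'n)"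
proof -
  \<comment> \<open>Chosen so that the steepness condition is an equality at distance
    \<open>\<epsilon>\<close>; it then holds at all larger distances.\<close>
  define \<eta> where "\<eta> = b * (1 + 1 / \<epsilon>) / (2 * \<epsilon>)"
  define k where "k = exp (- \<eta> * \<rho>\<^sup>2)"
  \<comment> \<open>The gap between the Gaussian's values at radii \<open>\<rho>1\<close> and
    \<open>\<rho>\<close>: starting below \<open>c * m\<close> means starting below the
    barrier.\<close>
  define c where "c = exp (- \<eta> * \<rho>1\<^sup>2) - k"
  have \<eta>: "0 < \<eta>" and k: "0 < k"
    using assms by (auto simp: \<eta>_def k_def add_pos_pos)
  have "0 < c"
    using assms \<eta> by (simp add: c_def k_def power_strict_mono)
  have "c \<le> 1"
  proof -
    have "exp (- \<eta> * \<rho>1\<^sup>2) \<le> 1"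
      using \<eta> by simp
    then show ?thesis
      using k unfolding c_def by linarith
  qed
  have main: "\<exists>x'\<in>cball z \<epsilon>. path_component {y \<in> ball z \<rho>. u y < m} x x'"
    if u: "gauss_tested b \<Omega> u" and z: "cball z \<rho> \<subseteq> \<Omega>" and x: "x \<in> cball z \<rho>1" "u x < c * m"
    for \<Omega> u m and z x :: "real ^ 'n"
  proof -
    have upos: "0 < u y" if "y \<in> cball z \<rho>" for y
      using gauss_testedD(2)[OF u] z that by blast
    have contu: "continuous_on (cball z \<rho>) u"
      using gauss_testedD(1)[OF u] z continuous_on_subset by blast
    have x_ball: "x \<in> ball z \<rho>"
      using x assms by auto
    then have "0 < u x"
      using upos ball_subset_cball by blast
    then have "0 < c * m"
      using x(2) by linarith
    then have m: "0 < m"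
      using \<open>0 < c\<close> zero_less_mult_pos by blast
    define S where "S = {y \<in> ball z \<rho>. u y - m * gauss \<eta> z y < - (m * k)}"
    have cont: "continuous_on (cball z \<rho>) (\<lambda>y. u y - m * gauss \<eta> z y)"
      by (intro continuous_intros contu)
    have "S = ball z \<rho> \<inter> (\<lambda>y. u y - m * gauss \<eta> z y) -` {..< - (m * k)}"
      by (auto simp: S_def)
    then have "open S"
      using continuous_open_preimage[OF continuous_on_subset[OF cont ball_subset_cball] open_ball
          open_lessThan] by simp
    have "exp (- \<eta> * \<rho>1\<^sup>2) \<le> gauss \<eta> z x"
      using x \<eta> by (intro gauss_ge) (auto simp: dist_norm norm_minus_commute)
    then have "c * m \<le> (gauss \<eta> z x - k) * m"
      using m by (simp add: c_def)
    then have "x \<in> S"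
      using x x_ball by (simp add: S_def algebra_simps)
    define D where "D = path_component_set S x"
    have "x \<in> D"
      using \<open>x \<in> S\<close> by (simp add: D_def path_component_refl)
    have "open D"
      using \<open>open S\<close> by (simp add: D_def open_path_component)
    have "D \<subseteq> S"
      unfolding D_def by (rule path_component_subset)
    then have clD: "closure D \<subseteq> cball z \<rho>"
      by (intro closure_minimal) (auto simp: S_def)
    have low: "u y < m" if "y \<in> S" for y
    proof -
      have "u y < m * (gauss \<eta> z y - k)"
        using that by (simp add: S_def algebra_simps)
      also have "\<dots> \<le> m * 1"
        using gauss_le_1[of \<eta> z y] \<eta> k m by (intro mult_left_mono) auto
      finally show ?thesis
        by simp
    qed
    have "D \<inter> cball z \<epsilon> \<noteq> {}"
    proof
      assume far: "D \<inter> cball z \<epsilon> = {}"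
      have "compact (closure D)"
        unfolding compact_closure by (rule bounded_subset[OF bounded_cball subset_trans[OF closure_subset clD]])
      moreover have "x \<in> closure D"
        using \<open>x \<in> D\<close> closure_subset by blast
      moreover have "continuous_on (closure D) (\<lambda>y. u y - m * gauss \<eta> z y)"
        using cont clD continuous_on_subset by blast
      ultimately have "\<exists>x0\<in>closure D. \<forall>y\<in>closure D.
          u x0 - m * gauss \<eta> z x0 \<le> u y - m * gauss \<eta> z y"
        by (intro continuous_attains_inf) auto
      then obtain x0 where x0: "x0 \<in> closure D"
        and min: "\<And>y. y \<in> closure D \<Longrightarrow> u x0 - m * gauss \<eta> z x0 \<le> u y - m * gauss \<eta> z y"
        by auto
      have ux0: "u x0 - m * gauss \<eta> z x0 < - (m * k)"
        using min[OF \<open>x \<in> closure D\<close>] \<open>x \<in> S\<close> by (simp add: S_def)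
      have x0_cball: "x0 \<in> cball z \<rho>"
        using x0 clD by blast
      \<comment> \<open>On the sphere the Gaussian equals \<open>k\<close> and \<open>u\<close> is
        positive, so the difference exceeds \<open>- (m * k)\<close>, whereas its minimum is below
        that value.\<close>
      have "x0 \<in> ball z \<rho>"
      proof (rule ccontr)
        assume "x0 \<notin> ball z \<rho>"
        then have "gauss \<eta> z x0 = k"
          using x0_cball by (auto simp: gauss_def k_def dist_norm norm_minus_commute)
        then show False
          using ux0 upos[OF x0_cball] by simp
      qed
      then have "x0 \<in> S"
        using ux0 by (simp add: S_def)
      then have "x0 \<in> D"
        using x0 frontier_path_component_disjoint[OF \<open>open S\<close>, of x] \<open>open D\<close>
        by (auto simp: D_def frontier_def interior_open)
      define r where "r = norm (x0 - z)"
      have r: "\<epsilon> < r"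
        using far \<open>x0 \<in> D\<close> by (auto simp: r_def dist_norm norm_minus_commute)
      have "b * (1 + 1 / r) \<le> b * (1 + 1 / \<epsilon>)"
        using r assms by (simp add: frac_le)
      also have "\<dots> = 2 * \<eta> * \<epsilon>"
        using assms by (simp add: \<eta>_def)
      also have "\<dots> \<le> 2 * \<eta> * r"
        using r \<eta> by simp
      finally have steep: "b * (1 + 1 / r) \<le> 2 * \<eta> * r" .
      have "m * gauss \<eta> z x0 * (2 * \<eta> * r) < b * u x0"
        unfolding r_def
      proof (rule gauss_tested_below[OF u _ _ m \<eta> \<open>open D\<close> \<open>x0 \<in> D\<close>])
        show "x0 \<in> \<Omega>" "x0 \<noteq> z"
          using x0_cball z r assms(2) by (auto simp: r_def)
        show "u x0 - m * gauss \<eta> z x0 \<le> u y - m * gauss \<eta> z y" if "y \<in> D" for y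
          using min that closure_subset by blast
        show "b * (1 + 1 / norm (x0 - z)) \<le> 2 * \<eta> * norm (x0 - z)"
          using steep by (simp only: r_def)
      qed
      \<comment> \<open>The contradiction: being below the barrier forces
        \<open>u x0 \<le> m * gauss \<eta> z x0\<close>, while steepness gives
        \<open>b \<le> 2 * \<eta> * r\<close>.\<close>
      also have "\<dots> \<le> b * (m * gauss \<eta> z x0)"
      proof (intro mult_left_mono)
        have "0 < m * k"
          using m k by simp
        then show "u x0 \<le> m * gauss \<eta> z x0"
          using ux0 by linarith
      qed (use assms in simp)
      also have "\<dots> \<le> m * gauss \<eta> z x0 * (2 * \<eta> * r)"
      proof -
        have "0 \<le> b * (1 / r)"
          using assms r by simp
        then have "b \<le> 2 * \<eta> * r"
          using steep by (simp add: algebra_simps)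
        then have "m * gauss \<eta> z x0 * b \<le> m * gauss \<eta> z x0 * (2 * \<eta> * r)"
          using m gauss_pos[of \<eta> z x0] by (intro mult_left_mono) auto
        then show ?thesis
          by (simp only: mult_ac)
      qed
      finally show False
        by simp
    qed
    then obtain x' where "x' \<in> cball z \<epsilon>" "path_component S x x'"
      by (auto simp: D_def)
    moreover have "S \<subseteq> {y \<in> ball z \<rho>. u y < m}"
      using low by (auto simp: S_def)
    ultimately show ?thesis
      using path_component_of_subset by blast
  qed
  show thesis
    using \<open>0 < c\<close> \<open>c \<le> 1\<close> main by (rule that)
qed

text \<open>Consecutive centres are \<open>e / 2\<close> apart, so a point within
  \<open>e / 4\<close> of one is within \<open>3 * e / 4\<close> of the next, and
  \<open>low_path_to_ball\<close> carries it on inside a ball of radius \<open>e\<close>. Each step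
  costs one constant factor. The set \<open>W\<close> records that the path stays in the tube;
  \<open>c\<close> precedes \<open>\<Omega>\<close>, \<open>u\<close> and the direction
  \<open>w\<close>, hence is uniform in them.\<close>

lemma low_path_along_segment:
  assumes "0 < b" "0 < e"
  shows "\<exists>c>0. \<forall>\<Omega> u z w W x m. gauss_tested b \<Omega> u \<longrightarrow> norm w = 1 \<longrightarrow>
    (\<forall>k\<le>n. cball (z + (real k * e / 2) *\<^sub>R w) e \<subseteq> \<Omega> \<inter> W) \<longrightarrow>
    x \<in> cball z (e / 4) \<longrightarrow> u x < c * m \<longrightarrow>
    (\<exists>x'\<in>cball (z + (real n * e / 2) *\<^sub>R w) (e / 4).
      path_component {y \<in> W. u y < m} x (x' :: real ^ 'n))"
proof (induction n)
  case 0
  show ?case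
  proof (intro exI[of _ 1] conjI allI impI)
    fix \<Omega> W :: "(real ^ 'n) set" and u :: "real ^ 'n \<Rightarrow> real" and z w x m
    assume *: "\<forall>k\<le>0. cball (z + (real k * e / 2) *\<^sub>R w) e \<subseteq> \<Omega> \<inter> W" "x \<in> cball z (e / 4)" "u x < 1 * m"
    then have "cball z (e / 4) \<subseteq> W"
      using assms subset_cball[of "e / 4" e z] by auto
    with *(2,3) have "x \<in> {y \<in> W. u y < m}"
      by auto
    then have "path_component {y \<in> W. u y < m} x x"
      by (rule path_component_refl)
    with * show "\<exists>x'\<in>cball (z + (real 0 * e / 2) *\<^sub>R w) (e / 4). path_component {y \<in> W. u y < m} x x'"
      by auto
  qed simp
next
  case (Suc n)
  then obtain c1 where c1: "0 < c1" and IH: "\<forall>\<Omega> u z w W x m. gauss_tested b \<Omega> u \<longrightarrow> norm w = 1 \<longrightarrow>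
      (\<forall>k\<le>n. cball (z + (real k * e / 2) *\<^sub>R w) e \<subseteq> \<Omega> \<inter> W) \<longrightarrow>
      x \<in> cball z (e / 4) \<longrightarrow> u x < c1 * m \<longrightarrow>
      (\<exists>x'\<in>cball (z + (real n * e / 2) *\<^sub>R w) (e / 4).
        path_component {y \<in> W. u y < m} x (x' :: real ^ 'n))"
    by (elim exE conjE)
  obtain c2 where c2: "0 < c2" "c2 \<le> 1"
    and step: "\<And>\<Omega> u z x m. \<lbrakk>gauss_tested b \<Omega> u; cball z e \<subseteq> \<Omega>; x \<in> cball z (3 * e / 4); u x < c2 * m\<rbrakk>
      \<Longrightarrow> \<exists>x'\<in>cball z (e / 4). path_component {y \<in> ball z e. u y < m} x (x' :: real ^ 'n)"
    by (rule low_path_to_ball[of b "e / 4" "3 * e / 4" e]) (use assms in auto)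
  show ?case
  proof (intro exI[of _ "c1 * c2"] conjI allI impI)
    show "0 < c1 * c2"
      using c1 c2 by simp
    fix \<Omega> :: "(real ^ 'n) set" and u z w W x m
    assume u: "gauss_tested b \<Omega> u" and w: "norm w = 1"
      and tube: "\<forall>k\<le>Suc n. cball (z + (real k * e / 2) *\<^sub>R w) e \<subseteq> \<Omega> \<inter> W"
      and x: "x \<in> cball z (e / 4)" "u x < c1 * c2 * m"
    let ?y = "\<lambda>k. z + (real k * e / 2) *\<^sub>R w"
    have tubeD: "cball (?y k) e \<subseteq> \<Omega>" "cball (?y k) e \<subseteq> W" if "k \<le> Suc n" for k
      using tube that by auto
    \<comment> \<open>The first \<open>n\<close> steps are run at the lower level
      \<open>c2 * m\<close>, so that their endpoint is low enough for one more step at level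
      \<open>m\<close>.\<close>
    obtain x1 where x1: "x1 \<in> cball (?y n) (e / 4)" "path_component {y \<in> W. u y < c2 * m} x x1"
    proof -
      have tube': "\<forall>k\<le>n. cball (?y k) e \<subseteq> \<Omega> \<inter> W"
        using tube le_Suc_eq by blast
      have "u x < c1 * (c2 * m)"
        using x(2) by (simp add: mult.assoc)
      then have "\<exists>x'\<in>cball (?y n) (e / 4). path_component {y \<in> W. u y < c2 * m} x x'"
        by (intro IH[THEN spec, THEN spec, THEN spec, THEN spec, THEN spec, THEN spec, THEN spec,
              THEN mp, THEN mp, THEN mp, THEN mp, THEN mp, OF u w tube' x(1)])
      then show thesis
        using that by blast
    qed
    have "u x1 < c2 * m"
      using path_component_mem(2)[OF x1(2)] by simp
    have next_centre: "real (Suc n) * e / 2 = real n * e / 2 + e / 2"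
      by (simp add: field_simps)
    have "?y (Suc n) = ?y n + (e / 2) *\<^sub>R w"
      by (simp only: next_centre scaleR_add_left add.assoc)
    then have "dist (?y n) (?y (Suc n)) = e / 2"
      using w assms by (simp add: dist_norm)
    then have "x1 \<in> cball (?y (Suc n)) (3 * e / 4)"
      using x1(1) dist_triangle[of "?y (Suc n)" x1 "?y n"] by (simp add: dist_commute)
    then obtain x2 where x2: "x2 \<in> cball (?y (Suc n)) (e / 4)"
      "path_component {y \<in> ball (?y (Suc n)) e. u y < m} x1 x2"
    proof -
      from step[OF u tubeD(1)[OF order_refl] _ \<open>u x1 < c2 * m\<close>] \<open>x1 \<in> cball (?y (Suc n)) (3 * e / 4)\<close> show thesis
        using that by blast
    qed
    have "0 < c2 * m"
    proof -
      have "x1 \<in> cball (?y n) e"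
        using x1(1) assms by auto
      then have "x1 \<in> \<Omega>"
        using tubeD(1)[of n] by auto
      then show ?thesis
        using gauss_testedD(2)[OF u, of x1] \<open>u x1 < c2 * m\<close> by linarith
    qed
    then have "0 < m"
      using c2 by (simp add: zero_less_mult_iff)
    then have "c2 * m \<le> m"
      using c2 by simp
    then have "{y \<in> W. u y < c2 * m} \<subseteq> {y \<in> W. u y < m}"
      by auto
    then have "path_component {y \<in> W. u y < m} x x1"
      using x1(2) by (rule path_component_of_subset)
    moreover have "path_component {y \<in> W. u y < m} x1 x2"
    proof (rule path_component_of_subset[OF _ x2(2)])
      show "{y \<in> ball (?y (Suc n)) e. u y < m} \<subseteq> {y \<in> W. u y < m}"
        using tubeD(2)[OF order_refl] ball_subset_cball by blast
    qed
    ultimately show "\<exists>x'\<in>cball (?y (Suc n)) (e / 4). path_component {y \<in> W. u y < m} x x'"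
      using x2(1) path_component_trans by blast
  qed
qed

subsection \<open>The planar crossing argument\<close>

text \<open>Reduction to \<open>fashoda\<close> in the linear coordinates \<open>v\<close> and
  \<open>w\<close>, which only have to separate points. The path in \<open>S\<close> may overshoot
  the rectangle in the \<open>v\<close> direction, the path in \<open>T\<close> in the
  \<open>w\<close> direction.\<close>

lemma path_components_cross:
  fixes P v w p q x y :: "real ^ 2"
  assumes vw: "\<And>s t. v \<bullet> s = v \<bullet> t \<Longrightarrow> w \<bullet> s = w \<bullet> t \<Longrightarrow> s = t"
    and "path_component S p q" "path_component T x y"
    and S: "\<And>s. s \<in> S \<Longrightarrow> \<bar>w \<bullet> (s - P)\<bar> < d" "v \<bullet> (p - P) \<le> a" "b \<le> v \<bullet> (q - P)"
    and T: "\<And>s. s \<in> T \<Longrightarrow> a < v \<bullet> (s - P) \<and> v \<bullet> (s - P) < b"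
      "w \<bullet> (x - P) \<le> - d" "d \<le> w \<bullet> (y - P)"
  shows "S \<inter> T \<noteq> {}"
proof -
  obtain f where f: "path f" "path_image f \<subseteq> S" "pathstart f = p" "pathfinish f = q"
    using assms(2) unfolding path_component_def by blast
  obtain g where g: "path g" "path_image g \<subseteq> T" "pathstart g = x" "pathfinish g = y"
    using assms(3) unfolding path_component_def by blast
  have fS: "f t \<in> S" and gT: "g t \<in> T" if "t \<in> {0..1}" for t
    using f(2) g(2) that by (auto simp: path_image_def)
  have "a < b" "0 < d"
    using T(1)[OF gT[of 0]] S(1)[OF fS[of 0]] by auto
  \<comment> \<open>Clamping the coordinate along which a path may leave the rectangle
    creates no new intersections: the other path stays strictly inside in that coordinate.\<close>
  define F :: "real \<Rightarrow> real ^ 2" where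
    "F t = (\<chi> i. if i = 1 then max a (min b (v \<bullet> (f t - P))) else w \<bullet> (f t - P))" for t
  define G :: "real \<Rightarrow> real ^ 2" where
    "G t = (\<chi> i. if i = 1 then v \<bullet> (g t - P) else max (- d) (min d (w \<bullet> (g t - P))))" for t
  define lo hi :: "real ^ 2" where "lo = (\<chi> i. if i = 1 then a else - d)"
    and "hi = (\<chi> i. if i = 1 then b else d)"
  have contf: "continuous_on {0..1} f" and contg: "continuous_on {0..1} g"
    using f(1) g(1) by (auto simp: path_def)
  have pathF: "path F"
    unfolding path_def F_def
  proof (rule continuous_on_vec_lambda)
    fix i :: 2
    show "continuous_on {0..1} (\<lambda>t. if i = 1 then max a (min b (v \<bullet> (f t - P))) else w \<bullet> (f t - P))"
      by (cases "i = 1") (auto intro!: continuous_intros contf)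
  qed
  have pathG: "path G"
    unfolding path_def G_def
  proof (rule continuous_on_vec_lambda)
    fix i :: 2
    show "continuous_on {0..1} (\<lambda>t. if i = 1 then v \<bullet> (g t - P) else max (- d) (min d (w \<bullet> (g t - P))))"
      by (cases "i = 1") (auto intro!: continuous_intros contg)
  qed
  have F_box: "path_image F \<subseteq> cbox lo hi"
  proof
    fix s assume "s \<in> path_image F"
    then obtain t where t: "t \<in> {0..1}" "s = F t"
      by (auto simp: path_image_def)
    then show "s \<in> cbox lo hi"
      using S(1)[OF fS[OF t(1)]] \<open>a < b\<close>
      by (auto simp: mem_box_cart F_def lo_def hi_def)
  qed
  have G_box: "path_image G \<subseteq> cbox lo hi"
  proof
    fix s assume "s \<in> path_image G"
    then obtain t where t: "t \<in> {0..1}" "s = G t"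
      by (auto simp: path_image_def)
    then show "s \<in> cbox lo hi"
      using T(1)[OF gT[OF t(1)]] \<open>0 < d\<close>
      by (auto simp: mem_box_cart G_def lo_def hi_def)
  qed
  have ends: "pathstart F $ 1 = lo $ 1" "pathfinish F $ 1 = hi $ 1"
    "pathstart G $ 2 = lo $ 2" "pathfinish G $ 2 = hi $ 2"
    using S(2,3) T(2,3) f(3,4) g(3,4) \<open>a < b\<close> \<open>0 < d\<close>
    by (auto simp: pathstart_def pathfinish_def F_def G_def lo_def hi_def)
  obtain s where "s \<in> path_image F" "s \<in> path_image G"
    using fashoda[OF pathF pathG F_box G_box ends] .
  then obtain t t' where t: "t \<in> {0..1}" "t' \<in> {0..1}" "F t = G t'"
    by (auto simp: path_image_def)
  have "F t $ 1 = G t' $ 1" "F t $ 2 = G t' $ 2"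
    using t(3) by simp_all
  then have "v \<bullet> (f t - P) = v \<bullet> (g t' - P)" "w \<bullet> (f t - P) = w \<bullet> (g t' - P)"
    using S(1)[OF fS[OF t(1)]] T(1)[OF gT[OF t(2)]]
    by (auto simp: F_def G_def max_def min_def split: if_splits)
  then have "f t = g t'"
    using vw[of "f t - P" "g t' - P"] by simp
  then show ?thesis
    using fS[OF t(1)] gT[OF t(2)] by auto
qed

text \<open>The component of \<open>P\<close> in the high part of an open square has a frontier
  point that is still high. Not belonging to that set, it must lie outside the open square, so some
  coordinate is large. A square is used since its sides match the rectangles to be crossed.\<close>

lemma high_path_from_centre:
  assumes "0 < b"
  shows "\<exists>R>0. \<forall>\<Omega> u P e. gauss_tested b \<Omega> u \<longrightarrow> 0 < e \<longrightarrow> 8 * e \<le> R \<longrightarrow> cball P (8 * e) \<subseteq> \<Omega> \<longrightarrow>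
    (\<exists>q i. path_component {x. (\<forall>j. \<bar>(x - P) $ j\<bar> < 4 * e) \<and> u P / 2 < u x} P (q :: real ^ 2) \<and>
      7 * e / 2 \<le> \<bar>(q - P) $ i\<bar>)"
proof -
  obtain R where R: "0 < R" and half:
    "\<And>\<Omega> u P D. \<lbrakk>gauss_tested b \<Omega> u; open D; P \<in> D; D \<subseteq> cball P R; closure D \<subseteq> \<Omega>\<rbrakk>
      \<Longrightarrow> \<exists>y\<in>frontier D. u P / 2 < u (y :: real ^ 2)"
    using frontier_value_gt_half[OF assms] by metis
  have main: "\<exists>q i. path_component {x. (\<forall>j. \<bar>(x - P) $ j\<bar> < 4 * e) \<and> u P / 2 < u x} P q \<and>
        7 * e / 2 \<le> \<bar>(q - P) $ i\<bar>"
    if u: "gauss_tested b \<Omega> u" and e: "0 < e" "8 * e \<le> R" and P: "cball P (8 * e) \<subseteq> \<Omega>"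
    for \<Omega> u e and P :: "real ^ 2"
  proof -
    define B where "B = {x :: real ^ 2. \<forall>j. \<bar>(x - P) $ j\<bar> < 4 * e}"
    define S where "S = {x. (\<forall>j. \<bar>(x - P) $ j\<bar> < 4 * e) \<and> u P / 2 < u x}"
    define D where "D = path_component_set S P"
    have "B = (\<Inter>j. {x. \<bar>(x - P) $ j\<bar> < 4 * e})"
      by (auto simp: B_def)
    moreover have "open (\<Inter>j\<in>UNIV :: 2 set. {x. \<bar>(x - P) $ j\<bar> < 4 * e})"
      by (intro open_INT ballI open_Collect_less continuous_intros) auto
    ultimately have "open B"
      by simp
    have B_sub: "B \<subseteq> cball P (8 * e)"
    proof
      fix x assume "x \<in> B"
      then have "\<bar>(x - P) $ 1\<bar> < 4 * e" "\<bar>(x - P) $ 2\<bar> < 4 * e"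
        by (auto simp: B_def)
      moreover have "norm (x - P) \<le> \<bar>(x - P) $ 1\<bar> + \<bar>(x - P) $ 2\<bar>"
        using norm_le_l1_cart[of "x - P"] by (simp add: sum_2)
      ultimately show "x \<in> cball P (8 * e)"
        by (simp add: dist_norm norm_minus_commute)
    qed
    have contu: "continuous_on B u"
      using continuous_on_subset[OF gauss_testedD(1)[OF u]] B_sub P by blast
    have S_eq: "S = B \<inter> u -` {u P / 2 <..}"
      by (auto simp: S_def B_def)
    have "open S"
      unfolding S_eq by (rule continuous_open_preimage[OF contu \<open>open B\<close> open_greaterThan])
    have "P \<in> \<Omega>"
      using P e by auto
    then have "P \<in> S"
      using e gauss_testedD(2)[OF u] by (simp add: S_def)
    then have "P \<in> D"
      by (simp add: D_def path_component_refl)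
    have "D \<subseteq> S"
      unfolding D_def by (rule path_component_subset)
    then have D_sub: "D \<subseteq> cball P (8 * e)"
      using B_sub S_eq by blast
    then have clD: "closure D \<subseteq> cball P (8 * e)"
      by (rule closure_minimal) simp
    have "D \<subseteq> cball P R"
      using D_sub e(2) by auto
    moreover have "open D"
      unfolding D_def by (rule open_path_component[OF \<open>open S\<close>])
    ultimately obtain y where y: "y \<in> frontier D" "u P / 2 < u y"
      using half[OF u, of D P] \<open>P \<in> D\<close> clD P by (meson subset_trans)
    have "y \<notin> S"
      using y(1) frontier_path_component_disjoint[OF \<open>open S\<close>, of P] by (auto simp: D_def)
    then obtain i where i: "4 * e \<le> \<bar>(y - P) $ i\<bar>"
      using y(2) by (auto simp: S_def not_less)
    have "y \<in> closure D"
      using y(1) by (simp add: frontier_def)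
    \<comment> \<open>The frontier point \<open>y\<close> is not in \<open>D\<close>; a nearby point
      of \<open>D\<close> gives up \<open>e / 2\<close> of the coordinate, whence
      \<open>7 * e / 2\<close> in place of \<open>4 * e\<close>.\<close>
    then obtain q where q: "q \<in> D" "dist q y < e / 2"
      using e(1) closure_approachable[of y D] half_gt_zero by blast
    have "\<bar>(q - y) $ i\<bar> < e / 2"
      using component_le_norm_cart[of "q - y" i] q(2) by (simp add: dist_norm)
    then have "7 * e / 2 \<le> \<bar>(q - P) $ i\<bar>"
      using i by (simp add: abs_if split: if_splits)
    moreover have "path_component S P q"
      using q(1) by (simp add: D_def)
    ultimately show ?thesis
      unfolding S_def by blast
  qed
  show ?thesis
    by (intro exI[of _ R] conjI allI impI R main)
qed

text \<open>If \<open>u Q\<close> were too small, a low path from near \<open>Q\<close> could be led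
  across the side towards which the high path from \<open>P\<close> travels, and the two would meet
  at a point where \<open>u\<close> is both above and below \<open>u P / 2\<close>. That side
  depends on \<open>u\<close>, but the constants are the same for all four sides.\<close>

lemma local_harnack:
  assumes "0 < b"
  obtains R where "0 < R"
    and "\<And>r. 0 < r \<Longrightarrow> r \<le> R \<Longrightarrow> \<exists>C>0. \<forall>\<Omega> u P Q. gauss_tested b \<Omega> u \<longrightarrow> cball P r \<subseteq> \<Omega> \<longrightarrow>
      dist P Q \<le> r / 16 \<longrightarrow> u P \<le> C * u (Q :: real ^ 2)"
proof -
  obtain R where R: "0 < R" and high:
    "\<forall>\<Omega> u P e. gauss_tested b \<Omega> u \<longrightarrow> 0 < e \<longrightarrow> 8 * e \<le> R \<longrightarrow> cball P (8 * e) \<subseteq> \<Omega> \<longrightarrow>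
      (\<exists>q i. path_component {x. (\<forall>j. \<bar>(x - P) $ j\<bar> < 4 * e) \<and> u P / 2 < u x} P (q :: real ^ 2) \<and>
        7 * e / 2 \<le> \<bar>(q - P) $ i\<bar>)"
    using high_path_from_centre[OF assms] by (elim exE conjE)
  have main: "\<exists>C>0. \<forall>\<Omega> u P Q. gauss_tested b \<Omega> u \<longrightarrow> cball P r \<subseteq> \<Omega> \<longrightarrow>
      dist P Q \<le> r / 16 \<longrightarrow> u P \<le> C * u (Q :: real ^ 2)"
    if r: "0 < r" "r \<le> R" for r
  proof -
    \<comment> \<open>With this unit everything fits into the disc of radius \<open>16 * e\<close>
      about \<open>P\<close>: the centres used below are within \<open>7 * e\<close> of
      \<open>P\<close>, the balls have radius at most \<open>9 * e\<close>, and \<open>Q\<close> is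
      within \<open>e\<close> of \<open>P\<close>.\<close>
    define e where "e = r / 16"
    have e: "0 < e" "8 * e \<le> R" "r = 16 * e"
      using r by (auto simp: e_def)
    obtain c1 where c1: "0 < c1" "c1 \<le> 1" and start:
      "\<And>\<Omega> u z x m. \<lbrakk>gauss_tested b \<Omega> u; cball z (9 * e) \<subseteq> \<Omega>; x \<in> cball z (8 * e); u x < c1 * m\<rbrakk>
      \<Longrightarrow> \<exists>x'\<in>cball z (e / 4). path_component {y \<in> ball z (9 * e). u y < m} x (x' :: real ^ 2)"
      by (rule low_path_to_ball[of b "e / 4" "8 * e" "9 * e"]) (use assms e in auto)
    \<comment> \<open>Twenty steps of length \<open>e / 2\<close> lead from height
      \<open>- 5 * e\<close> to \<open>5 * e\<close> in the \<open>w\<close> direction, past the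
      square's half-side \<open>4 * e\<close> by more than the error \<open>e / 4\<close> at each
      end.\<close>
    obtain c2 where c2: "0 < c2" and along:
      "\<forall>\<Omega> u z w W x m. gauss_tested b \<Omega> u \<longrightarrow> norm w = 1 \<longrightarrow>
        (\<forall>k\<le>20. cball (z + (real k * e / 2) *\<^sub>R w) e \<subseteq> \<Omega> \<inter> W) \<longrightarrow>
        x \<in> cball z (e / 4) \<longrightarrow> u x < c2 * m \<longrightarrow>
        (\<exists>x'\<in>cball (z + (real 20 * e / 2) *\<^sub>R w) (e / 4).
          path_component {y \<in> W. u y < m} x (x' :: real ^ 2))"
      using low_path_along_segment[OF assms e(1), of 20, where 'n = 2] by (elim exE conjE)
    have "u P \<le> 2 / (c1 * c2) * u Q"
      if u: "gauss_tested b \<Omega> u" and P: "cball P r \<subseteq> \<Omega>" and Q: "dist P Q \<le> r / 16"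
      for \<Omega> u and P Q :: "real ^ 2"
    proof (rule ccontr)
      assume contra: "\<not> u P \<le> 2 / (c1 * c2) * u Q"
      define m where "m = u P / 2"
      have uQ: "u Q < c1 * (c2 * m)"
        using contra c1 c2 by (simp add: m_def field_simps)
      have "cball P (8 * e) \<subseteq> \<Omega>"
        using P e by (auto simp: subset_iff)
      then obtain q i where q: "path_component {x. (\<forall>j. \<bar>(x - P) $ j\<bar> < 4 * e) \<and> m < u x} P q"
        "7 * e / 2 \<le> \<bar>(q - P) $ i\<bar>"
        using high[rule_format, OF u e(1,2)] unfolding m_def by blast
      define j :: 2 where "j = (if i = 1 then 2 else 1)"
      \<comment> \<open>The sign makes \<open>v\<close> point towards the side of the square that
        the high path approaches.\<close>
      define \<sigma> :: real where "\<sigma> = (if 0 \<le> (q - P) $ i then 1 else - 1)"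
      define v w where "v = axis i \<sigma>" and "w = axis j (1 :: real)"
      have v_inner: "v \<bullet> x = \<sigma> * x $ i" and w_inner: "w \<bullet> x = x $ j" for x
        by (simp_all add: v_def w_def inner_axis')
      have "i \<noteq> j"
        by (simp add: j_def)
      have norms: "norm v = 1" "norm w = 1"
        by (simp_all add: v_def w_def \<sigma>_def norm_eq_sqrt_inner inner_axis_axis)
      have ortho: "v \<bullet> v = 1" "w \<bullet> w = 1" "v \<bullet> w = 0" "w \<bullet> v = 0"
        using \<open>i \<noteq> j\<close> norms by (auto simp: norm_eq_1 v_inner w_inner) (auto simp: v_def w_def axis_def)
      have coords: "s = t" if "v \<bullet> s = v \<bullet> t" "w \<bullet> s = w \<bullet> t" for s t
        using that by (auto simp: v_inner w_inner vec_eq_iff forall_2 j_def \<sigma>_def split: if_splits)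
          (metis exhaust_2)+
      have inner_le: "\<bar>v \<bullet> x\<bar> \<le> norm x" "\<bar>w \<bullet> x\<bar> \<le> norm x" for x
        using Cauchy_Schwarz_ineq2[of v x] Cauchy_Schwarz_ineq2[of w x] norms by simp_all
      \<comment> \<open>The lower end of the low path, on the midline of the strip
        \<open>W\<close>.\<close>
      define z where "z = P + (2 * e) *\<^sub>R v - (5 * e) *\<^sub>R w"
      define W where "W = {s. e \<le> v \<bullet> (s - P) \<and> v \<bullet> (s - P) \<le> 3 * e}"
      have centre: "z + (real k * e / 2) *\<^sub>R w - P = (2 * e) *\<^sub>R v + (real k * e / 2 - 5 * e) *\<^sub>R w" for k
        by (simp add: z_def scaleR_diff_left)
      have dist_centre: "dist P (z + (real k * e / 2) *\<^sub>R w) \<le> 7 * e" if "k \<le> 20" for k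
      proof -
        have "real k * e \<le> 20 * e"
          using that e by (intro mult_right_mono) auto
        then have "\<bar>real k * e / 2 - 5 * e\<bar> \<le> 5 * e"
          using e by (simp add: abs_le_iff)
        then have "norm ((2 * e) *\<^sub>R v + (real k * e / 2 - 5 * e) *\<^sub>R w) \<le> 2 * e + 5 * e"
          using norms e by (intro norm_triangle_mono) auto
        then have "norm (z + (real k * e / 2) *\<^sub>R w - P) \<le> 7 * e"
          unfolding centre by simp
        then show ?thesis
          by (simp only: dist_norm norm_minus_commute[of P])
      qed
      have "dist P z \<le> 7 * e"
        using dist_centre[of 0] by simp
      then have "Q \<in> cball z (8 * e)"
        using Q dist_triangle[of z Q P] by (simp add: e(3) dist_commute)
      moreover have "cball z (9 * e) \<subseteq> \<Omega>"
      proof -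
        have "cball z (9 * e) \<subseteq> cball P r"
          using \<open>dist P z \<le> 7 * e\<close> by (intro cball_subset_cball_iff[THEN iffD2]) (auto simp: e(3) dist_commute)
        then show ?thesis
          using P by (rule subset_trans)
      qed
      \<comment> \<open>The path from \<open>Q\<close> to \<open>x0\<close> need not stay in
        \<open>W\<close>, so only the value \<open>u x0 < c2 * m\<close> is carried on.\<close>
      ultimately obtain x0 where x0: "x0 \<in> cball z (e / 4)"
        "path_component {y \<in> ball z (9 * e). u y < c2 * m} Q x0"
        using start[OF u _ _ uQ] by blast
      have ux0: "u x0 < c2 * m"
        using path_component_mem(2)[OF x0(2)] by simp
      have tube: "\<forall>k\<le>20. cball (z + (real k * e / 2) *\<^sub>R w) e \<subseteq> \<Omega> \<inter> W"
      proof (intro allI impI subsetI IntI)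
        fix k s assume k: "k \<le> (20 :: nat)" and s: "s \<in> cball (z + (real k * e / 2) *\<^sub>R w) e"
        let ?y = "z + (real k * e / 2) *\<^sub>R w"
        have "dist P s \<le> r"
          using dist_triangle[of P s ?y] dist_centre[OF k] s e by simp
        then show "s \<in> \<Omega>"
          using P by auto
        have "v \<bullet> (s - P) = v \<bullet> (s - ?y) + v \<bullet> (?y - P)"
          by (simp add: inner_diff_right)
        also have "v \<bullet> (?y - P) = 2 * e"
          unfolding centre by (simp add: inner_add_right ortho)
        finally have "v \<bullet> (s - P) = v \<bullet> (s - ?y) + 2 * e" .
        moreover have "\<bar>v \<bullet> (s - ?y)\<bar> \<le> e"
          using inner_le(1)[of "s - ?y"] s by (simp add: dist_norm norm_minus_commute)
        ultimately show "s \<in> W"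
          by (simp add: W_def abs_le_iff)
      qed
      have "\<exists>x1\<in>cball (z + (real 20 * e / 2) *\<^sub>R w) (e / 4). path_component {y \<in> W. u y < m} x0 x1"
        by (intro along[THEN spec, THEN spec, THEN spec, THEN spec, THEN spec, THEN spec, THEN spec,
              THEN mp, THEN mp, THEN mp, THEN mp, THEN mp, OF u norms(2) tube x0(1) ux0])
      then obtain x1 where x1: "x1 \<in> cball (z + (real 20 * e / 2) *\<^sub>R w) (e / 4)"
        "path_component {y \<in> W. u y < m} x0 x1"
        by blast
      have "{x. (\<forall>j. \<bar>(x - P) $ j\<bar> < 4 * e) \<and> m < u x} \<inter> {y \<in> W. u y < m} \<noteq> {}"
      \<comment> \<open>The rectangle has \<open>v\<close> between \<open>e / 2\<close> and
        \<open>7 * e / 2\<close> and half-height \<open>4 * e\<close>. The strip \<open>W\<close>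
        lies strictly inside in the \<open>v\<close> direction, while \<open>P\<close> and
        \<open>q\<close> lie on or beyond opposite ends.\<close>
      proof (rule path_components_cross[OF coords q(1) x1(2)])
        show "\<bar>w \<bullet> (s - P)\<bar> < 4 * e" if "s \<in> {x. (\<forall>j. \<bar>(x - P) $ j\<bar> < 4 * e) \<and> m < u x}" for s
          using that unfolding w_inner by blast
        show "v \<bullet> (P - P) \<le> e / 2"
          using e by simp
        show "7 * e / 2 \<le> v \<bullet> (q - P)"
          using q(2) unfolding v_inner \<sigma>_def by (simp add: abs_if split: if_splits)
        show "e / 2 < v \<bullet> (s - P) \<and> v \<bullet> (s - P) < 7 * e / 2" if "s \<in> {y \<in> W. u y < m}" for s
          using that e by (auto simp: W_def)
        have "w \<bullet> (x0 - P) = w \<bullet> (x0 - z) + w \<bullet> (z - P)"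
          by (simp add: inner_diff_right)
        moreover have "w \<bullet> (z - P) = - 5 * e"
          by (simp add: z_def inner_diff_right inner_add_right ortho)
        moreover have "\<bar>w \<bullet> (x0 - z)\<bar> \<le> e / 4"
          using inner_le(2)[of "x0 - z"] x0(1) by (simp add: dist_norm norm_minus_commute)
        ultimately show "w \<bullet> (x0 - P) \<le> - (4 * e)"
          using e by linarith
        let ?y = "z + (real 20 * e / 2) *\<^sub>R w"
        have "w \<bullet> (x1 - P) = w \<bullet> (x1 - ?y) + w \<bullet> (?y - P)"
          by (simp add: inner_diff_right)
        moreover have "w \<bullet> (?y - P) = 5 * e"
          unfolding centre by (simp add: inner_add_right ortho)
        moreover have "\<bar>w \<bullet> (x1 - ?y)\<bar> \<le> e / 4"
          using inner_le(2)[of "x1 - ?y"] x1(1) by (simp add: dist_norm norm_minus_commute)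
        ultimately show "4 * e \<le> w \<bullet> (x1 - P)"
          using e by linarith
      qed
      then show False
        by auto
    qed
    then show ?thesis
      using c1 c2 by (intro exI[of _ "2 / (c1 * c2)"]) auto
  qed
  show thesis
    using R main by (rule that)
qed

subsection \<open>From local to global\<close>

text \<open>Comparability with a constant uniform over the family is an equivalence relation with
  relatively open classes, so a connected set is a single class. Compactness then replaces the
  pointwise constants by one.\<close>

lemma harnack_chain:
  fixes \<Omega> :: "'a::metric_space set" and \<U> :: "('a \<Rightarrow> real) set"
  assumes "connected \<Omega>" "compact T" "T \<subseteq> \<Omega>"
    and pos: "\<And>u x. u \<in> \<U> \<Longrightarrow> x \<in> \<Omega> \<Longrightarrow> 0 < u x"
    and near: "\<And>x. x \<in> \<Omega> \<Longrightarrow> \<exists>\<delta>>0. \<exists>C>0. ball x \<delta> \<subseteq> \<Omega> \<and>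
      (\<forall>u\<in>\<U>. \<forall>y\<in>ball x \<delta>. u x \<le> C * u y \<and> u y \<le> C * u x)"
  shows "\<exists>K>0. \<forall>u\<in>\<U>. \<forall>x\<in>T. \<forall>y\<in>T. u x \<le> K * u y"
proof (cases "T = {}")
  case True
  then show ?thesis
    by (intro exI[of _ 1]) auto
next
  case False
  then obtain o' where o': "o' \<in> \<Omega>"
    using assms by blast
  define R where "R x y \<longleftrightarrow> (\<exists>C>0. \<forall>u\<in>\<U>. u x \<le> C * u y \<and> u y \<le> C * u x)" for x y
  have trans: "R x z" if xy: "R x y" and yz: "R y z" for x y z
  proof -
    obtain C C' where C: "C > 0" "\<And>u. u \<in> \<U> \<Longrightarrow> u x \<le> C * u y \<and> u y \<le> C * u x"
      and C': "C' > 0" "\<And>u. u \<in> \<U> \<Longrightarrow> u y \<le> C' * u z \<and> u z \<le> C' * u y"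
      using xy yz unfolding R_def by metis
    have "u x \<le> (C * C') * u z \<and> u z \<le> (C * C') * u x" if "u \<in> \<U>" for u
    proof
      have "u x \<le> C * u y"
        using C(2)[OF that] by simp
      also have "\<dots> \<le> C * (C' * u z)"
        using C'(2)[OF that] C(1) by simp
      finally show "u x \<le> (C * C') * u z"
        by (simp add: mult.assoc)
      have "u z \<le> C' * u y"
        using C'(2)[OF that] by simp
      also have "\<dots> \<le> C' * (C * u x)"
        using C(2)[OF that] C'(1) by simp
      finally show "u z \<le> (C * C') * u x"
        by (simp add: mult_ac)
    qed
    then show ?thesis
      unfolding R_def using C(1) C'(1) by (intro exI[of _ "C * C'"]) auto
  qed
  have "R x y" if "x \<in> \<Omega>" "y \<in> \<Omega>" for x y
  proof (rule connected_equivalence_relation[OF \<open>connected \<Omega>\<close> that])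
    show "R t s" if "R s t" for s t
      using that unfolding R_def by blast
    show "R s t" if "R s s'" "R s' t" for s s' t
      using trans that by blast
    show "\<exists>T. openin (top_of_set \<Omega>) T \<and> a \<in> T \<and> (\<forall>x\<in>T. R a x)" if "a \<in> \<Omega>" for a
    proof -
      obtain \<delta> C where "\<delta> > 0" "C > 0" "ball a \<delta> \<subseteq> \<Omega>"
        "\<forall>u\<in>\<U>. \<forall>y\<in>ball a \<delta>. u a \<le> C * u y \<and> u y \<le> C * u a"
        using near[OF \<open>a \<in> \<Omega>\<close>] by blast
      then show ?thesis
        by (intro exI[of _ "ball a \<delta>"]) (auto simp: R_def open_subset)
    qed
  qed
  then have to_o: "R o' x" if "x \<in> \<Omega>" for x
    using that o' by blast
  \<comment> \<open>Comparison with the base point \<open>o'\<close> is extended from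
    \<open>x\<close> to a whole ball with one constant, as a covering argument requires.\<close>
  have "\<exists>\<delta>>0. \<exists>C>0. \<forall>u\<in>\<U>. \<forall>y\<in>ball x \<delta>. u o' \<le> C * u y \<and> u y \<le> C * u o'" if "x \<in> \<Omega>" for x
  proof -
    obtain \<delta> C where \<delta>: "\<delta> > 0" "C > 0"
      "\<And>u y. u \<in> \<U> \<Longrightarrow> y \<in> ball x \<delta> \<Longrightarrow> u x \<le> C * u y \<and> u y \<le> C * u x"
      using near[OF \<open>x \<in> \<Omega>\<close>] by blast
    obtain C' where C': "C' > 0" "\<And>u. u \<in> \<U> \<Longrightarrow> u o' \<le> C' * u x \<and> u x \<le> C' * u o'"
      using to_o[OF \<open>x \<in> \<Omega>\<close>] unfolding R_def by blast
    have "u o' \<le> (C * C') * u y \<and> u y \<le> (C * C') * u o'" if "u \<in> \<U>" "y \<in> ball x \<delta>" for u y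
    proof
      have "u o' \<le> C' * u x"
        using C'(2)[OF that(1)] by simp
      also have "\<dots> \<le> C' * (C * u y)"
        using \<delta>(3)[OF that] C'(1) by simp
      finally show "u o' \<le> (C * C') * u y"
        by (simp add: mult_ac)
      have "u y \<le> C * u x"
        using \<delta>(3)[OF that] by simp
      also have "\<dots> \<le> C * (C' * u o')"
        using C'(2)[OF that(1)] \<delta>(2) by simp
      finally show "u y \<le> (C * C') * u o'"
        by (simp add: mult_ac)
    qed
    then have "\<exists>C>0. \<forall>u\<in>\<U>. \<forall>y\<in>ball x \<delta>. u o' \<le> C * u y \<and> u y \<le> C * u o'"
      using \<delta>(2) C'(1) by (intro exI[of _ "C * C'"]) auto
    then show ?thesis
      using \<delta>(1) by blast
  qed
  then obtain \<delta> \<kappa> where \<delta>: "\<And>x. x \<in> \<Omega> \<Longrightarrow> \<delta> x > 0" and \<kappa>: "\<And>x. x \<in> \<Omega> \<Longrightarrow> \<kappa> x > 0"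
    and bound: "\<And>x u y. x \<in> \<Omega> \<Longrightarrow> u \<in> \<U> \<Longrightarrow> y \<in> ball x (\<delta> x) \<Longrightarrow> u o' \<le> \<kappa> x * u y \<and> u y \<le> \<kappa> x * u o'"
    by metis
  obtain N where N: "N \<subseteq> T" "finite N" "T \<subseteq> (\<Union>x\<in>N. ball x (\<delta> x))"
  proof (rule compactE_image[OF \<open>compact T\<close>, of T "\<lambda>x. ball x (\<delta> x)"])
    show "T \<subseteq> (\<Union>x\<in>T. ball x (\<delta> x))"
      using \<delta> \<open>T \<subseteq> \<Omega>\<close> by force
  qed (use that in auto)
  \<comment> \<open>All summands are positive, so the sum dominates each of the finitely many
    constants; the added 1 gives \<open>0 < k\<close> at once. Passing through \<open>o'\<close>
    squares it.\<close>
  define k where "k = 1 + (\<Sum>x\<in>N. \<kappa> x)"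
  have N\<Omega>: "x \<in> \<Omega>" if "x \<in> N" for x
    using that N(1) \<open>T \<subseteq> \<Omega>\<close> by blast
  have "0 \<le> (\<Sum>x\<in>N. \<kappa> x)"
    using \<kappa> N\<Omega> by (intro sum_nonneg) (auto intro: less_imp_le)
  then have "0 < k"
    by (simp add: k_def)
  have via_o: "u o' \<le> k * u y \<and> u y \<le> k * u o'" if "u \<in> \<U>" "y \<in> T" for u y
  proof -
    obtain x where x: "x \<in> N" "y \<in> ball x (\<delta> x)"
      using N(3) \<open>y \<in> T\<close> by blast
    have "\<kappa> x \<le> (\<Sum>x\<in>N. \<kappa> x)"
      using x(1) N(2) \<kappa> N\<Omega> by (intro member_le_sum) (auto intro: less_imp_le)
    then have "\<kappa> x \<le> k"
      by (simp add: k_def)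
    moreover have "0 < u y" "0 < u o'"
      using pos that o' \<open>T \<subseteq> \<Omega>\<close> by auto
    ultimately have "\<kappa> x * u y \<le> k * u y" "\<kappa> x * u o' \<le> k * u o'"
      by simp_all
    then show ?thesis
      using bound[OF N\<Omega>[OF x(1)] that(1) x(2)] by linarith
  qed
  have "u x \<le> (k * k) * u y" if "u \<in> \<U>" "x \<in> T" "y \<in> T" for u x y
  proof -
    have "u x \<le> k * u o'"
      using via_o that by blast
    also have "\<dots> \<le> k * (k * u y)"
      using via_o that \<open>0 < k\<close> by (intro mult_left_mono) auto
    finally show ?thesis
      by (simp add: mult.assoc)
  qed
  then show ?thesis
    using \<open>0 < k\<close> by (intro exI[of _ "k * k"]) auto
qed

theorem theorem3p1:
  fixes \<alpha> a A h_sup V_sup :: real and \<Omega> \<Omega>' :: "(real ^ 2) set"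
  assumes "\<alpha> > -1"
    and "open \<Omega>" and "connected \<Omega>" and "bounded \<Omega>"
    and "0 < a" and "a \<le> A"
    and "compact (closure \<Omega>')" and "closure \<Omega>' \<subseteq> \<Omega>" and "\<Omega>' \<noteq> {}"
  shows "\<exists>K :: real. \<forall>(F :: 2 nonlinearity) (h :: real ^ 2 \<Rightarrow> real ^ 2) (V :: real ^ 2 \<Rightarrow> real)
           (u :: real ^ 2 \<Rightarrow> real).
      H1 \<alpha> \<Omega> F \<longrightarrow> H2 \<alpha> a A \<Omega> F \<longrightarrow> H3 \<alpha> \<Omega> F \<longrightarrow> H4 \<Omega> F \<longrightarrow>
      continuous_on (closure \<Omega>) h \<longrightarrow> bounded (h ` closure \<Omega>) \<longrightarrow>
      continuous_on (closure \<Omega>) V \<longrightarrow> bounded (V ` closure \<Omega>) \<longrightarrow>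
      (SUP x\<in>closure \<Omega>. norm (h x)) = h_sup \<longrightarrow>
      (SUP x\<in>closure \<Omega>. \<bar>V x\<bar>) = V_sup \<longrightarrow>
      H5 \<alpha> (closure \<Omega>) h \<longrightarrow>
      visc_solution \<alpha> \<Omega> F h V (\<lambda>_. 0) u \<longrightarrow> (\<forall>x\<in>\<Omega>. u x > 0) \<longrightarrow>
      (SUP x\<in>\<Omega>'. u x) \<le> K * (INF x\<in>\<Omega>'. u x)"
proof -
  have "0 \<le> A"
    using assms by simp
  obtain b where b: "0 < b"
    and tested: "\<And>F h V u. \<lbrakk>H1 \<alpha> \<Omega> F; H2 \<alpha> a A \<Omega> F; \<And>x. x \<in> \<Omega> \<Longrightarrow> norm (h x) \<le> h_sup;
      \<And>x. x \<in> \<Omega> \<Longrightarrow> \<bar>V x\<bar> \<le> V_sup; visc_solution \<alpha> \<Omega> F h V (\<lambda>_. 0) u; \<And>x. x \<in> \<Omega> \<Longrightarrow> 0 < u x\<rbrakk>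
      \<Longrightarrow> gauss_tested b \<Omega> u"
    using visc_solution_imp_gauss_tested[OF \<open>\<alpha> > -1\<close> \<open>0 < a\<close> \<open>0 \<le> A\<close>,
        where \<Omega> = \<Omega> and h_sup = h_sup and V_sup = V_sup] by blast
  obtain R where R: "0 < R" and harnack: "\<And>r. 0 < r \<Longrightarrow> r \<le> R \<Longrightarrow>
      \<exists>C>0. \<forall>\<Omega> u P Q. gauss_tested b \<Omega> u \<longrightarrow> cball P r \<subseteq> \<Omega> \<longrightarrow>
      dist P Q \<le> r / 16 \<longrightarrow> u P \<le> C * u (Q :: real ^ 2)"
    using local_harnack[OF b] by metis
  have "\<exists>K>0. \<forall>u\<in>{u. gauss_tested b \<Omega> u}. \<forall>x\<in>closure \<Omega>'. \<forall>y\<in>closure \<Omega>'. u x \<le> K * u y"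
  proof (rule harnack_chain[OF \<open>connected \<Omega>\<close> assms(7,8)])
    show "0 < u x" if "u \<in> {u. gauss_tested b \<Omega> u}" "x \<in> \<Omega>" for u x
      using that gauss_testedD(2) by blast
    fix P assume "P \<in> \<Omega>"
    then obtain \<rho> where \<rho>: "0 < \<rho>" "cball P \<rho> \<subseteq> \<Omega>"
      using \<open>open \<Omega>\<close> open_contains_cball by blast
    \<comment> \<open>Half of \<open>\<rho>\<close> leaves room for the disc of radius
      \<open>r\<close> about each nearby \<open>Q\<close>, so the local estimate applies with
      \<open>P\<close> and \<open>Q\<close> interchanged.\<close>
    define r where "r = min R (\<rho> / 2)"
    have r: "0 < r" "r \<le> R" "2 * r \<le> \<rho>"
      using R \<rho> by (auto simp: r_def)
    obtain C where C: "C > 0" "\<forall>\<Omega> u P Q. gauss_tested b \<Omega> u \<longrightarrow> cball P r \<subseteq> \<Omega> \<longrightarrow>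
      dist P Q \<le> r / 16 \<longrightarrow> u P \<le> C * u (Q :: real ^ 2)"
      using harnack[OF r(1,2)] by blast
    have "u P \<le> C * u Q \<and> u Q \<le> C * u P" if "gauss_tested b \<Omega> u" "Q \<in> ball P (r / 16)" for u Q
    proof
      have PQ: "dist P Q \<le> r / 16"
        using that by simp
      have "cball P r \<subseteq> cball P \<rho>" "cball Q r \<subseteq> cball P \<rho>"
        using r PQ by (auto simp: cball_subset_cball_iff dist_commute)
      then have "cball P r \<subseteq> \<Omega>" "cball Q r \<subseteq> \<Omega>"
        using \<rho>(2) by auto
      then show "u P \<le> C * u Q" "u Q \<le> C * u P"
        using C(2)[rule_format, OF that(1)] PQ by (auto simp: dist_commute)
    qed
    moreover have "ball P (r / 16) \<subseteq> \<Omega>"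
      using r \<rho>(2) by (auto simp: subset_iff)
    ultimately have "\<exists>C>0. ball P (r / 16) \<subseteq> \<Omega> \<and>
        (\<forall>u\<in>{u. gauss_tested b \<Omega> u}. \<forall>y\<in>ball P (r / 16). u P \<le> C * u y \<and> u y \<le> C * u P)"
      using C(1) by (intro exI[of _ C]) simp
    then show "\<exists>\<delta>>0. \<exists>C>0. ball P \<delta> \<subseteq> \<Omega> \<and>
        (\<forall>u\<in>{u. gauss_tested b \<Omega> u}. \<forall>y\<in>ball P \<delta>. u P \<le> C * u y \<and> u y \<le> C * u P)"
      using r(1) by (intro exI[of _ "r / 16"]) simp
  qed
  then obtain K where K: "K > 0"
    "\<And>u x y. gauss_tested b \<Omega> u \<Longrightarrow> x \<in> closure \<Omega>' \<Longrightarrow> y \<in> closure \<Omega>' \<Longrightarrow> u x \<le> K * u y"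
    by blast
  show ?thesis
  proof (intro exI[of _ K] allI impI)
    fix F :: "2 nonlinearity" and h :: "real ^ 2 \<Rightarrow> real ^ 2" and V u :: "real ^ 2 \<Rightarrow> real"
    assume F: "H1 \<alpha> \<Omega> F" "H2 \<alpha> a A \<Omega> F"
      and bdd: "bounded (h ` closure \<Omega>)" "bounded (V ` closure \<Omega>)"
      and sups: "(SUP x\<in>closure \<Omega>. norm (h x)) = h_sup" "(SUP x\<in>closure \<Omega>. \<bar>V x\<bar>) = V_sup"
      and u: "visc_solution \<alpha> \<Omega> F h V (\<lambda>_. 0) u" "\<forall>x\<in>\<Omega>. u x > 0"
    have "norm (h x) \<le> h_sup" if "x \<in> \<Omega>" for x
      unfolding sups(1)[symmetric]
    \<comment> \<open>A supremum of reals is an upper bound only for a set bounded above, which is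
      where the boundedness of \<open>h\<close> enters.\<close>
    proof (rule cSUP_upper)
      obtain M where "\<forall>x\<in>closure \<Omega>. norm (h x) \<le> M"
        using bdd(1) by (auto simp: bounded_iff)
      then show "bdd_above ((\<lambda>x. norm (h x)) ` closure \<Omega>)"
        by (intro bdd_aboveI2[of _ _ M]) auto
    qed (use that closure_subset in blast)
    moreover have "\<bar>V x\<bar> \<le> V_sup" if "x \<in> \<Omega>" for x
      unfolding sups(2)[symmetric]
    proof (rule cSUP_upper)
      obtain M where "\<forall>x\<in>closure \<Omega>. norm (V x) \<le> M"
        using bdd(2) by (auto simp: bounded_iff)
      then show "bdd_above ((\<lambda>x. \<bar>V x\<bar>) ` closure \<Omega>)"
        by (intro bdd_aboveI2[of _ _ M]) auto
    qed (use that closure_subset in blast)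
    ultimately have "gauss_tested b \<Omega> u"
      using tested[OF F _ _ u(1)] u(2) by blast
    then have le: "u x \<le> K * u y" if "x \<in> \<Omega>'" "y \<in> \<Omega>'" for x y
      using K(2) that closure_subset by blast
    show "(SUP x\<in>\<Omega>'. u x) \<le> K * (INF x\<in>\<Omega>'. u x)"
    proof (rule cSUP_least[OF \<open>\<Omega>' \<noteq> {}\<close>])
      fix x assume "x \<in> \<Omega>'"
      have "u x / K \<le> (INF x\<in>\<Omega>'. u x)"
        using le[OF \<open>x \<in> \<Omega>'\<close>] K(1)
        by (intro cINF_greatest[OF \<open>\<Omega>' \<noteq> {}\<close>]) (simp add: pos_divide_le_eq mult.commute)
      then show "u x \<le> K * (INF x\<in>\<Omega>'. u x)"
        using K(1) by (simp add: pos_divide_le_eq mult.commute)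
    qed
  qed
qed

end
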